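(* Let $M=\mathbb{R}^3$ with coordinates $(t,x,y)$, let $h=h(t)$ be a smooth real valued function of $t$ only, and let $g_h$ be the metric on $M$ whose nonzero entries on the coordinate frame (up to symmetry) are $$g_h(\partial_t,\partial_t)=g_h(\partial_x,\partial_y)=1,\qquad g_h(\partial_x,\partial_x)=-2h.$$ Suppose that $h''$ is nowhere vanishing. \begin{enumerate} \item $(M,g_h)$ is $CH_0$. \item If $h'''$ is nowhere vanishing, then $(M,g_h)$ is $SCH_1(1,3)$. \item The quantity $\left(\frac{h'''}{h''}\right)^2$ is an isometry invariant, and if it is nonconstant, then $(M,g_h)$ is not $CH_1$, and is therefore not locally homogeneous. \item Suppose $h'$ and $h'''$ are nowhere vanishing. If $(M,g_h)$ is $SCH_2(1,3)$, then it is $CH_2$. As a result, if $h$ is analytic, then $SCH_2(1,3)$ implies that $(M,g_h)$ is locally homogeneous. \end{enumerate}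
   Context: $\nabla$ is the Levi-Civita connection of a smooth pseudo-Riemannian manifold $(M,g)$. The curvature operator is $\mathcal{R}(X,Y)Z = \nabla_X\nabla_YZ-\nabla_Y\nabla_XZ-\nabla_{[X,Y]}Z$ and the curvature tensor is $R(X,Y,Z,W)=g(\mathcal{R}(X,Y)Z,W)$. $\nabla^k\mathcal{R}_P$ and $\nabla^kR_P$ denote their $k$-th covariant derivatives at $P$. For an invertible linear map $H:T_PM\to T_QM$, $H^*\nabla^kR_Q$ denotes precomposition with $H$ in every input, and $$H^*\nabla^k\mathcal{R}_Q(x,y,z;v_1,\ldots,v_k)=H^{-1}\nabla^k\mathcal{R}_Q(Hx,Hy,Hz;Hv_1,\ldots,Hv_k).$$ A homothety $H:T_PM\to T_QM$ is a linear isometry followed by a dilation, i.e. $H=\lambda F$ with $\lambda>0$ and $F$ a linear isometry. $(M,g)$ is $CH_r$ ($r$-curvature homogeneous) if for every $P,Q\in M$ there is a linear isometry $F:T_PM\to T_QM$ with $F^*\nabla^kR_Q=\nabla^kR_P$ for all $k=0,\ldots,r$. $(M,g)$ is $SCH_r(1,3)$ (strongly $r$-curvature homogeneous of type $(1,3)$) if for every $P,Q\in M$ there is a single homothety $H:T_PM\to T_QM$ with $H^*\nabla^k\mathcal{R}_Q=\nabla^k\mathcal{R}_P$ for all $k=0,\ldots,r$. "Isometry invariant" means that the value of the quantity at $P$ agrees with its value at $Q$ (for a possibly different member of the same family of manifolds) whenever there is an isometry from a neighborhood of $P$ to a neighborhood of $Q$ taking $P$ to $Q$. Locally homogeneous means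 that for all $P,Q\in M$ there is an isometry from a neighborhood of $P$ to a neighborhood of $Q$ taking $P$ to $Q$. *)

theory Defs
  imports "HOL-Analysis.Analysis"
begin

text \<open>
  The manifolds are \<open>\<real>\<^sup>n\<close> (type \<^typ>\<open>real ^ 'n\<close>) with its global chart, every tangent space
  being identified with \<open>\<real>\<^sup>n\<close> through the coordinate frame.  A metric is the matrix-valued
  function of its components; a vector field is a function \<open>\<real>\<^sup>n \<rightarrow> \<real>\<^sup>n\<close>.
\<close>

subsection \<open>Smooth and real analytic maps\<close>

text \<open>Continuous differentiability of order \<open>k\<close>, intended for open \<open>S\<close> and a finite-dimensional
  domain, where it suffices to iterate directional derivatives.\<close>

primrec Ck_on ::
  "nat \<Rightarrow> 'a::real_normed_vector set \<Rightarrow> ('a \<Rightarrow> 'b::real_normed_vector) \<Rightarrow> bool" where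
  "Ck_on 0 S f \<longleftrightarrow> continuous_on S f"
| "Ck_on (Suc k) S f \<longleftrightarrow>
     (\<forall>x\<in>S. f differentiable (at x)) \<and> (\<forall>v. Ck_on k S (\<lambda>x. frechet_derivative f (at x) v))"

definition smooth_on ::
  "'a::real_normed_vector set \<Rightarrow> ('a \<Rightarrow> 'b::real_normed_vector) \<Rightarrow> bool" where
  "smooth_on S f \<longleftrightarrow> (\<forall>k. Ck_on k S f)"

definition real_analytic :: "(real \<Rightarrow> real) \<Rightarrow> bool" where
  "real_analytic f \<longleftrightarrow>
     (\<forall>a. \<exists>r>0. \<exists>c. \<forall>t. \<bar>t - a\<bar> < r \<longrightarrow> (\<lambda>n. c n * (t - a) ^ n) sums f t)"

subsection \<open>Pseudo-Riemannian metrics and the Levi-Civita connection\<close>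

type_synonym 'n metric = "real ^ 'n \<Rightarrow> real ^ 'n ^ 'n"
type_synonym 'n vfield = "real ^ 'n \<Rightarrow> real ^ 'n"
type_synonym 'n connection = "'n vfield \<Rightarrow> 'n vfield \<Rightarrow> 'n vfield"

definition form :: "real ^ 'n ^ 'n \<Rightarrow> real ^ 'n \<Rightarrow> real ^ 'n \<Rightarrow> real" where
  "form A u v = u \<bullet> (A *v v)"

definition pseudo_riemannian :: "'n::finite metric \<Rightarrow> bool" where
  "pseudo_riemannian g \<longleftrightarrow>
     smooth_on UNIV g \<and> (\<forall>P. transpose (g P) = g P \<and> invertible (g P))"

definition christoffel :: "'n::finite metric \<Rightarrow> real ^ 'n \<Rightarrow> 'n \<Rightarrow> 'n \<Rightarrow> 'n \<Rightarrow> real" where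
  "christoffel g P k i j =
     (let d = (\<lambda>a b c. frechet_derivative g (at P) (axis a 1) $ b $ c)
      in (1 / 2) * (\<Sum>l\<in>UNIV. matrix_inv (g P) $ k $ l * (d i j l + d j i l - d l i j)))"

definition levi_civita :: "'n::finite metric \<Rightarrow> 'n connection" where
  "levi_civita g X Y P =
     frechet_derivative Y (at P) (X P)
     + (\<chi> k. \<Sum>i\<in>UNIV. \<Sum>j\<in>UNIV. christoffel g P k i j * X P $ i * Y P $ j)"

definition lie_bracket :: "'n::finite vfield \<Rightarrow> 'n vfield \<Rightarrow> 'n vfield" where
  "lie_bracket X Y P =
     frechet_derivative Y (at P) (X P) - frechet_derivative X (at P) (Y P)"

subsection \<open>Curvature and its covariant derivatives\<close>

definition curvature :: "'n::finite connection \<Rightarrow> 'n vfield \<Rightarrow> 'n vfield \<Rightarrow> 'n vfield \<Rightarrow> 'n vfield" where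
  "curvature D X Y Z P = D X (D Y Z) P - D Y (D X Z) P - D (lie_bracket X Y) Z P"

text \<open>
  A tensor field of type \<open>(0,m)\<close> or \<open>(1,m)\<close> is a function of the base point and of the list of its
  \<open>m\<close> vector arguments; its values on lists of any other length are meaningless.  Where a formula
  needs vector fields extending given vectors at \<open>P\<close>, the extensions with constant components are
  used; by tensoriality the choice is immaterial.  Covariant differentiation appends the
  direction of differentiation as the last argument.
\<close>

type_synonym 'n tensor0 = "real ^ 'n \<Rightarrow> (real ^ 'n) list \<Rightarrow> real"
type_synonym 'n tensor1 = "real ^ 'n \<Rightarrow> (real ^ 'n) list \<Rightarrow> real ^ 'n"

definition cov_deriv0 :: "'n::finite connection \<Rightarrow> 'n tensor0 \<Rightarrow> 'n tensor0" where
  "cov_deriv0 D T P vs =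
     (let xs = butlast vs; v = last vs
      in frechet_derivative (\<lambda>p. T p xs) (at P) v
         - (\<Sum>i<length xs. T P (xs[i := D (\<lambda>_. v) (\<lambda>_. xs ! i) P])))"

definition cov_deriv1 :: "'n::finite connection \<Rightarrow> 'n tensor1 \<Rightarrow> 'n tensor1" where
  "cov_deriv1 D T P vs =
     (let xs = butlast vs; v = last vs
      in D (\<lambda>_. v) (\<lambda>p. T p xs) P
         - (\<Sum>i<length xs. T P (xs[i := D (\<lambda>_. v) (\<lambda>_. xs ! i) P])))"

definition curv_op :: "'n::finite metric \<Rightarrow> 'n tensor1" where
  "curv_op g P vs = curvature (levi_civita g) (\<lambda>_. vs ! 0) (\<lambda>_. vs ! 1) (\<lambda>_. vs ! 2) P"

definition curv_tensor :: "'n::finite metric \<Rightarrow> 'n tensor0" where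
  "curv_tensor g P vs = form (g P) (curv_op g P (take 3 vs)) (vs ! 3)"

definition nabla_curv_op :: "nat \<Rightarrow> 'n::finite metric \<Rightarrow> 'n tensor1" where
  "nabla_curv_op k g = (cov_deriv1 (levi_civita g) ^^ k) (curv_op g)"

definition nabla_curv_tensor :: "nat \<Rightarrow> 'n::finite metric \<Rightarrow> 'n tensor0" where
  "nabla_curv_tensor k g = (cov_deriv0 (levi_civita g) ^^ k) (curv_tensor g)"

subsection \<open>Homogeneity\<close>

definition linear_isometry ::
  "real ^ 'n ^ 'n \<Rightarrow> real ^ 'n ^ 'n \<Rightarrow> (real ^ 'n \<Rightarrow> real ^ 'n) \<Rightarrow> bool" where
  "linear_isometry A B F \<longleftrightarrow> linear F \<and> bij F \<and> (\<forall>u v. form B (F u) (F v) = form A u v)"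

definition homothety ::
  "real ^ 'n ^ 'n \<Rightarrow> real ^ 'n ^ 'n \<Rightarrow> (real ^ 'n \<Rightarrow> real ^ 'n) \<Rightarrow> bool" where
  "homothety A B H \<longleftrightarrow> (\<exists>c F. c > 0 \<and> linear_isometry A B F \<and> H = (\<lambda>u. c *\<^sub>R F u))"

definition curvature_homogeneous :: "nat \<Rightarrow> 'n::finite metric \<Rightarrow> bool" where
  "curvature_homogeneous r g \<longleftrightarrow>
     (\<forall>P Q. \<exists>F. linear_isometry (g P) (g Q) F \<and>
       (\<forall>k\<le>r. \<forall>vs. length vs = 4 + k \<longrightarrow>
          nabla_curv_tensor k g Q (map F vs) = nabla_curv_tensor k g P vs))"

definition strongly_curvature_homogeneous_13 :: "nat \<Rightarrow> 'n::finite metric \<Rightarrow> bool" where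
  "strongly_curvature_homogeneous_13 r g \<longleftrightarrow>
     (\<forall>P Q. \<exists>H. homothety (g P) (g Q) H \<and>
       (\<forall>k\<le>r. \<forall>vs. length vs = 3 + k \<longrightarrow>
          inv H (nabla_curv_op k g Q (map H vs)) = nabla_curv_op k g P vs))"

text \<open>An isometry from a neighbourhood of \<open>P\<close> in \<open>(\<real>\<^sup>n, g)\<close> to a neighbourhood of \<open>Q\<close> in
  \<open>(\<real>\<^sup>n, g')\<close> taking \<open>P\<close> to \<open>Q\<close>.\<close>

definition locally_isometric_at ::
  "'n::finite metric \<Rightarrow> real ^ 'n \<Rightarrow> 'n metric \<Rightarrow> real ^ 'n \<Rightarrow> bool" where
  "locally_isometric_at g P g' Q \<longleftrightarrow>
     (\<exists>U V \<phi> \<psi>. open U \<and> open V \<and> P \<in> U \<and> \<phi> ` U = V \<and> \<phi> P = Q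
        \<and> (\<forall>p\<in>U. \<psi> (\<phi> p) = p) \<and> smooth_on U \<phi> \<and> smooth_on V \<psi>
        \<and> (\<forall>p\<in>U. linear_isometry (g p) (g' (\<phi> p)) (frechet_derivative \<phi> (at p))))"

definition locally_homogeneous :: "'n::finite metric \<Rightarrow> bool" where
  "locally_homogeneous g \<longleftrightarrow> (\<forall>P Q. locally_isometric_at g P g Q)"

subsection \<open>The family of metrics\<close>

text \<open>The coordinates \<open>(t, x, y)\<close> of a point \<open>P\<close> are \<open>P $ 1\<close>, \<open>P $ 2\<close>, \<open>P $ 3\<close>.\<close>

definition metric_h :: "(real \<Rightarrow> real) \<Rightarrow> 3 metric" where
  "metric_h h P =
     vector [vector [1, 0, 0],
             vector [0, - 2 * h (P $ 1), 1],
             vector [0, 1, 0]]"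

definition isometry_invariant ::
  "((real \<Rightarrow> real) \<Rightarrow> bool) \<Rightarrow> ((real \<Rightarrow> real) \<Rightarrow> real ^ 3 \<Rightarrow> real) \<Rightarrow> bool" where
  "isometry_invariant \<H> I \<longleftrightarrow>
     (\<forall>h h' P Q. \<H> h \<and> \<H> h' \<and> locally_isometric_at (metric_h h) P (metric_h h') Q
        \<longrightarrow> I h P = I h' Q)"

subsection \<open>The axioms of the Levi-Civita connection\<close>

text \<open>For a pseudo-Riemannian metric, \<^const>\<open>levi_civita\<close> is the unique torsion-free metric affine
  connection on smooth vector fields: see \<open>levi_civita_characterization\<close>.\<close>

definition affine_connection :: "'n::finite connection \<Rightarrow> bool" where
  "affine_connection D \<longleftrightarrow>
     (\<forall>X X' Y Y' f. smooth_on UNIV X \<and> smooth_on UNIV X' \<and> smooth_on UNIV Y \<and> smooth_on UNIV Y'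
         \<and> smooth_on UNIV (f :: real ^ 'n \<Rightarrow> real) \<longrightarrow>
       (\<forall>P. D (\<lambda>p. X p + X' p) Y P = D X Y P + D X' Y P
          \<and> D (\<lambda>p. f p *\<^sub>R X p) Y P = f P *\<^sub>R D X Y P
          \<and> D X (\<lambda>p. Y p + Y' p) P = D X Y P + D X Y' P
          \<and> D X (\<lambda>p. f p *\<^sub>R Y p) P
              = frechet_derivative f (at P) (X P) *\<^sub>R Y P + f P *\<^sub>R D X Y P))"

definition torsion_free :: "'n::finite connection \<Rightarrow> bool" where
  "torsion_free D \<longleftrightarrow>
     (\<forall>X Y. smooth_on UNIV X \<and> smooth_on UNIV Y \<longrightarrow>
       (\<forall>P. D X Y P - D Y X P = lie_bracket X Y P))"

definition metric_connection :: "'n::finite metric \<Rightarrow> 'n connection \<Rightarrow> bool" where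
  "metric_connection g D \<longleftrightarrow>
     (\<forall>X Y Z. smooth_on UNIV X \<and> smooth_on UNIV Y \<and> smooth_on UNIV Z \<longrightarrow>
       (\<forall>P. frechet_derivative (\<lambda>p. form (g p) (Y p) (Z p)) (at P) (X P)
          = form (g P) (D X Y P) (Z P) + form (g P) (Y P) (D X Z P)))"

lemma smooth_on_differentiable: "smooth_on S f \<Longrightarrow> x \<in> S \<Longrightarrow> f differentiable (at x)"
  unfolding smooth_on_def using Ck_on.simps(2) by blast

lemma Ck_on_const: "Ck_on k S (\<lambda>_. c)"
  by (induction k arbitrary: c) auto

lemma smooth_on_const: "smooth_on S (\<lambda>_. c)"
  by (simp add: smooth_on_def Ck_on_const)

lemma form_add_left: "form A (u + v) w = form A u w + form A v w"
  and form_add_right: "form A u (v + w) = form A u v + form A u w"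
  and form_diff_left: "form A (u - v) w = form A u w - form A v w"
  by (simp_all add: form_def inner_add_left inner_add_right inner_diff_left matrix_vector_right_distrib)

lemma form_sym: "transpose A = A \<Longrightarrow> form A u v = form A v u"
  by (metis form_def dot_lmul_matrix inner_commute transpose_matrix_vector)

lemma form_sum: "form A u v = (\<Sum>i\<in>UNIV. \<Sum>j\<in>UNIV. A $ i $ j * u $ i * v $ j)"
  by (simp add: form_def inner_vec_def matrix_vector_mult_def sum_distrib_left mult_ac)

lemma form_nondegenerate:
  assumes "transpose A = A" "invertible A" and "\<And>w. form A u w = 0"
  shows "u = 0"
proof -
  have "w \<bullet> (A *v u) = 0" for w
    using assms(3)[of w] form_sym[OF assms(1), of u w] by (simp add: form_def)
  then have "A *v u = 0" by (metis inner_eq_zero_iff)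
  then show ?thesis
    by (metis assms(2) invertible_def matrix_left_invertible_ker)
qed

lemma transpose_has_derivative_entries:
  assumes "pseudo_riemannian g"
  shows "frechet_derivative g (at P) v $ i $ j = frechet_derivative g (at P) v $ j $ i"
proof -
  have d: "(g has_derivative frechet_derivative g (at P)) (at P)"
    using assms smooth_on_differentiable frechet_derivative_works
    unfolding pseudo_riemannian_def by blast
  have e: "((\<lambda>p. g p $ i $ j) has_derivative (\<lambda>v. frechet_derivative g (at P) v $ i $ j)) (at P)" for i j
    by (intro bounded_linear.has_derivative[OF bounded_linear_vec_nth] d)
  have "(\<lambda>p. g p $ i $ j) = (\<lambda>p. g p $ j $ i)"
    using assms unfolding pseudo_riemannian_def transpose_def
    by (intro ext) (metis (mono_tags, lifting) vec_lambda_beta)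
  then show ?thesis using has_derivative_unique[OF e[of i j]] e[of j i] by metis
qed


lemma metric_has_derivative:
  assumes "pseudo_riemannian g"
  shows "(g has_derivative frechet_derivative g (at P)) (at P)"
  using assms smooth_on_differentiable frechet_derivative_works
  unfolding pseudo_riemannian_def by blast

lemma form_metric_derivative:
  assumes "pseudo_riemannian g"
  shows "form (frechet_derivative g (at P) u) v w =
    (\<Sum>i\<in>UNIV. \<Sum>j\<in>UNIV. \<Sum>l\<in>UNIV.
       frechet_derivative g (at P) (axis i 1) $ j $ l * u $ i * v $ j * w $ l)"
proof -
  let ?d = "frechet_derivative g (at P)"
  have lin: "linear ?d" using has_derivative_linear[OF metric_has_derivative[OF assms]] .
  have u: "u = (\<Sum>i\<in>UNIV. (u $ i) *\<^sub>R axis i 1)"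
    by (simp add: vec_eq_iff axis_def if_distrib cong: if_cong)
  have "?d u = (\<Sum>i\<in>UNIV. (u $ i) *\<^sub>R ?d (axis i 1))"
    by (subst u) (simp only: linear_sum[OF lin] linear_cmul[OF lin])
  then have "?d u $ j $ l = (\<Sum>i\<in>UNIV. u $ i * ?d (axis i 1) $ j $ l)" for j l
    by (simp add: sum_component)
  then have "form (?d u) v w =
     (\<Sum>j\<in>UNIV. \<Sum>l\<in>UNIV. \<Sum>i\<in>UNIV. ?d (axis i 1) $ j $ l * u $ i * v $ j * w $ l)"
    by (simp add: form_sum sum_distrib_left sum_distrib_right mult_ac)
  also have "\<dots> = (\<Sum>j\<in>UNIV. \<Sum>i\<in>UNIV. \<Sum>l\<in>UNIV. ?d (axis i 1) $ j $ l * u $ i * v $ j * w $ l)"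
    by (intro sum.cong refl sum.swap)
  also have "\<dots> = (\<Sum>i\<in>UNIV. \<Sum>j\<in>UNIV. \<Sum>l\<in>UNIV. ?d (axis i 1) $ j $ l * u $ i * v $ j * w $ l)"
    by (rule sum.swap)
  finally show ?thesis .
qed

lemma form_christoffel:
  fixes g :: "'n::finite metric"
  assumes "pseudo_riemannian g"
  shows "form (g P) (\<chi> k. \<Sum>i\<in>UNIV. \<Sum>j\<in>UNIV. christoffel g P k i j * u $ i * v $ j) w =
    (1 / 2) * (form (frechet_derivative g (at P) u) v w + form (frechet_derivative g (at P) v) u w
      - form (frechet_derivative g (at P) w) u v)"
proof -
  let ?d = "\<lambda>a b c. frechet_derivative g (at P) (axis a 1) $ b $ c"
  define A where "A = g P"
  have A: "transpose A = A" "invertible A"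
    using assms by (auto simp: A_def pseudo_riemannian_def)
  define q :: "real ^ 'n" where "q = (\<chi> l. \<Sum>i\<in>UNIV. \<Sum>j\<in>UNIV.
     (1 / 2) * (?d i j l + ?d j i l - ?d l i j) * u $ i * v $ j)"
  have "(\<chi> k. \<Sum>i\<in>UNIV. \<Sum>j\<in>UNIV. christoffel g P k i j * u $ i * v $ j) = matrix_inv A *v q"
  proof -
    have "(\<Sum>i\<in>UNIV. \<Sum>j\<in>UNIV. christoffel g P k i j * u $ i * v $ j) = (matrix_inv A *v q) $ k" for k
    proof -
      have "(matrix_inv A *v q) $ k = (\<Sum>l\<in>UNIV. \<Sum>i\<in>UNIV. \<Sum>j\<in>UNIV. matrix_inv A $ k $ l *
         ((1 / 2) * (?d i j l + ?d j i l - ?d l i j) * u $ i * v $ j))"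
        by (simp add: matrix_vector_mult_def q_def sum_distrib_left)
      also have "\<dots> = (\<Sum>i\<in>UNIV. \<Sum>l\<in>UNIV. \<Sum>j\<in>UNIV. matrix_inv A $ k $ l *
         ((1 / 2) * (?d i j l + ?d j i l - ?d l i j) * u $ i * v $ j))"
        by (rule sum.swap)
      also have "\<dots> = (\<Sum>i\<in>UNIV. \<Sum>j\<in>UNIV. \<Sum>l\<in>UNIV. matrix_inv A $ k $ l *
         ((1 / 2) * (?d i j l + ?d j i l - ?d l i j) * u $ i * v $ j))"
        by (intro sum.cong refl sum.swap)
      also have "\<dots> = (\<Sum>i\<in>UNIV. \<Sum>j\<in>UNIV. christoffel g P k i j * u $ i * v $ j)"
        by (simp add: christoffel_def Let_def A_def sum_distrib_left sum_distrib_right mult_ac)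
      finally show ?thesis by simp
    qed
    then show ?thesis by (simp add: vec_eq_iff)
  qed
  moreover have "A ** matrix_inv A = mat 1"
    using A(2) unfolding invertible_def matrix_inv_def by (rule someI2_ex) blast
  ultimately have "form A (\<chi> k. \<Sum>i\<in>UNIV. \<Sum>j\<in>UNIV. christoffel g P k i j * u $ i * v $ j) w = w \<bullet> q"
    using form_sym[OF A(1)] by (simp add: form_def matrix_vector_mul_assoc)
  also have "\<dots> = (\<Sum>l\<in>UNIV. \<Sum>i\<in>UNIV. \<Sum>j\<in>UNIV.
      (1 / 2) * (?d i j l * u $ i * v $ j * w $ l + ?d j i l * u $ i * v $ j * w $ l
        - ?d l i j * u $ i * v $ j * w $ l))"
    by (simp add: inner_vec_def q_def sum_distrib_left algebra_simps)
  also have "\<dots> = (1 / 2) *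
     ((\<Sum>l\<in>UNIV. \<Sum>i\<in>UNIV. \<Sum>j\<in>UNIV. ?d i j l * u $ i * v $ j * w $ l)
      + (\<Sum>l\<in>UNIV. \<Sum>i\<in>UNIV. \<Sum>j\<in>UNIV. ?d j i l * u $ i * v $ j * w $ l)
      - (\<Sum>l\<in>UNIV. \<Sum>i\<in>UNIV. \<Sum>j\<in>UNIV. ?d l i j * u $ i * v $ j * w $ l))"
    by (simp only: sum.distrib sum_subtractf flip: sum_distrib_left)
  also have "(\<Sum>l\<in>UNIV. \<Sum>i\<in>UNIV. \<Sum>j\<in>UNIV. ?d i j l * u $ i * v $ j * w $ l)
     = form (frechet_derivative g (at P) u) v w"
  proof -
    have "(\<Sum>l\<in>UNIV. \<Sum>i\<in>UNIV. \<Sum>j\<in>UNIV. ?d i j l * u $ i * v $ j * w $ l)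
      = (\<Sum>i\<in>UNIV. \<Sum>l\<in>UNIV. \<Sum>j\<in>UNIV. ?d i j l * u $ i * v $ j * w $ l)" by (rule sum.swap)
    also have "\<dots> = (\<Sum>i\<in>UNIV. \<Sum>j\<in>UNIV. \<Sum>l\<in>UNIV. ?d i j l * u $ i * v $ j * w $ l)"
      by (intro sum.cong refl sum.swap)
    finally show ?thesis by (simp add: form_metric_derivative[OF assms])
  qed
  also have "(\<Sum>l\<in>UNIV. \<Sum>i\<in>UNIV. \<Sum>j\<in>UNIV. ?d j i l * u $ i * v $ j * w $ l)
     = form (frechet_derivative g (at P) v) u w"
  proof -
    have "(\<Sum>l\<in>UNIV. \<Sum>i\<in>UNIV. \<Sum>j\<in>UNIV. ?d j i l * u $ i * v $ j * w $ l)
      = (\<Sum>l\<in>UNIV. \<Sum>j\<in>UNIV. \<Sum>i\<in>UNIV. ?d j i l * u $ i * v $ j * w $ l)"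
      by (intro sum.cong refl sum.swap)
    also have "\<dots> = (\<Sum>j\<in>UNIV. \<Sum>l\<in>UNIV. \<Sum>i\<in>UNIV. ?d j i l * u $ i * v $ j * w $ l)"
      by (rule sum.swap)
    also have "\<dots> = (\<Sum>j\<in>UNIV. \<Sum>i\<in>UNIV. \<Sum>l\<in>UNIV. ?d j i l * u $ i * v $ j * w $ l)"
      by (intro sum.cong refl sum.swap)
    finally show ?thesis by (simp add: form_metric_derivative[OF assms] mult_ac)
  qed
  also have "(\<Sum>l\<in>UNIV. \<Sum>i\<in>UNIV. \<Sum>j\<in>UNIV. ?d l i j * u $ i * v $ j * w $ l)
     = form (frechet_derivative g (at P) w) u v"
    by (simp add: form_metric_derivative[OF assms] mult_ac)
  finally show ?thesis by (simp add: A_def)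
qed

lemma form_metric_derivative_sym:
  assumes "pseudo_riemannian g"
  shows "form (frechet_derivative g (at P) u) v w = form (frechet_derivative g (at P) u) w v"
  by (rule form_sym) (simp add: vec_eq_iff transpose_def transpose_has_derivative_entries[OF assms, of P u])

lemma metric_connectionD:
  assumes "metric_connection g D" "smooth_on UNIV X" "smooth_on UNIV Y" "smooth_on UNIV Z"
  shows "frechet_derivative (\<lambda>p. form (g p) (Y p) (Z p)) (at P) (X P)
    = form (g P) (D X Y P) (Z P) + form (g P) (Y P) (D X Z P)"
  using assms by (simp add: metric_connection_def)

lemma koszul_unique:
  assumes g: "pseudo_riemannian g"
    and D: "torsion_free D" "metric_connection g D"
    and E: "torsion_free E" "metric_connection g E"
    and X: "smooth_on UNIV X" and Y: "smooth_on UNIV Y"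
  shows "D X Y P = E X Y P"
proof -
  have gP: "transpose (g P) = g P" "invertible (g P)"
    using g by (auto simp: pseudo_riemannian_def)
  note s = form_sym[OF gP(1)]
  have "form (g P) (D X Y P - E X Y P) w = 0" for w
  proof -
    define Z where "Z = (\<lambda>_::real ^ 'a. w)"
    have Z: "smooth_on UNIV Z" by (simp add: Z_def smooth_on_const)
    have t: "D U V P - D V U P = E U V P - E V U P"
      if "smooth_on UNIV U" "smooth_on UNIV V" for U V
      using D(1) E(1) that unfolding torsion_free_def by metis
    have c: "form (g P) (D U V P) (W P) + form (g P) (V P) (D U W P) =
       form (g P) (E U V P) (W P) + form (g P) (V P) (E U W P)"
      if "smooth_on UNIV U" "smooth_on UNIV V" "smooth_on UNIV W" for U V W
      by (simp only: metric_connectionD[OF D(2) that, symmetric] metric_connectionD[OF E(2) that, symmetric])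
    define S where "S U V = D U V P - E U V P" for U V
    have t': "S U V = S V U" if "smooth_on UNIV U" "smooth_on UNIV V" for U V
      using t[OF that] by (simp add: S_def algebra_simps)
    have c': "form (g P) (S U V) (W P) + form (g P) (S U W) (V P) = 0"
      if "smooth_on UNIV U" "smooth_on UNIV V" "smooth_on UNIV W" for U V W
      using c[OF that] s[of "V P" "D U W P"] s[of "V P" "E U W P"]
      by (simp add: S_def form_diff_left)
    have "form (g P) (S X Y) (Z P) = 0"
      using c'[OF X Y Z] c'[OF Y Z X] c'[OF Z X Y] t'[OF X Y] t'[OF Y Z] t'[OF X Z] by simp
    then show ?thesis by (simp add: S_def Z_def)
  qed
  then show ?thesis using form_nondegenerate[OF gP] by force
qed

lemma smooth_has_derivative:
  "smooth_on UNIV f \<Longrightarrow> (f has_derivative frechet_derivative f (at P)) (at P)"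
  using smooth_on_differentiable frechet_derivative_works by blast

lemma levi_civita_affine: "affine_connection (levi_civita g)"
  unfolding affine_connection_def
proof (intro allI impI, elim conjE, intro conjI)
  fix X X' Y Y' :: "'a vfield" and f :: "real ^ 'a \<Rightarrow> real" and P
  assume s: "smooth_on UNIV X" "smooth_on UNIV X'" "smooth_on UNIV Y" "smooth_on UNIV Y'" "smooth_on UNIV f"
  note dX = smooth_has_derivative[OF s(1), of P] and dY = smooth_has_derivative[OF s(3), of P]
    and dY' = smooth_has_derivative[OF s(4), of P] and df = smooth_has_derivative[OF s(5), of P]
  have lin: "linear (frechet_derivative Y (at P))" using has_derivative_linear[OF dY] .
  show "levi_civita g (\<lambda>p. X p + X' p) Y P = levi_civita g X Y P + levi_civita g X' Y P"
    by (simp add: levi_civita_def linear_add[OF lin] vec_eq_iff sum.distrib algebra_simps)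
  show "levi_civita g (\<lambda>p. f p *\<^sub>R X p) Y P = f P *\<^sub>R levi_civita g X Y P"
    by (simp add: levi_civita_def linear_cmul[OF lin] vec_eq_iff sum_distrib_left algebra_simps)
  show "levi_civita g X (\<lambda>p. Y p + Y' p) P = levi_civita g X Y P + levi_civita g X Y' P"
    unfolding levi_civita_def frechet_derivative_at[OF has_derivative_add[OF dY dY'], symmetric]
    by (simp add: vec_eq_iff sum.distrib algebra_simps)
  show "levi_civita g X (\<lambda>p. f p *\<^sub>R Y p) P
      = frechet_derivative f (at P) (X P) *\<^sub>R Y P + f P *\<^sub>R levi_civita g X Y P"
    unfolding levi_civita_def frechet_derivative_at[OF has_derivative_scaleR[OF df dY], symmetric]
    by (simp add: vec_eq_iff sum_distrib_left algebra_simps)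
qed

lemma levi_civita_torsion_free:
  assumes "pseudo_riemannian g"
  shows "torsion_free (levi_civita g)"
proof -
  have c: "christoffel g P k i j = christoffel g P k j i" for P k i j
  proof -
    have "frechet_derivative g (at P) v $ i $ j = frechet_derivative g (at P) v $ j $ i" for v
      by (rule transpose_has_derivative_entries[OF assms])
    then show ?thesis by (simp add: christoffel_def Let_def algebra_simps)
  qed
  have sw: "(\<Sum>i\<in>UNIV. \<Sum>j\<in>UNIV. christoffel g P k i j * u $ i * v $ j)
    = (\<Sum>i\<in>UNIV. \<Sum>j\<in>UNIV. christoffel g P k i j * v $ i * u $ j)" for P k u v
    by (subst sum.swap, intro sum.cong refl, subst c) (simp add: mult_ac)
  have e: "(\<chi> k. \<Sum>i\<in>UNIV. \<Sum>j\<in>UNIV. christoffel g P k i j * u $ i * v $ j)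
    = (\<chi> k. \<Sum>i\<in>UNIV. \<Sum>j\<in>UNIV. christoffel g P k i j * v $ i * u $ j)" for P u v
    by (rule arg_cong[where f = vec_lambda], rule ext, rule sw)
  show ?thesis
    unfolding torsion_free_def levi_civita_def lie_bracket_def
    by (intro allI impI) (subst e, simp)
qed

lemma bounded_bilinear_matrix_vector_mult:
  "bounded_bilinear ((*v) :: real ^ 'n ^ 'm \<Rightarrow> real ^ 'n \<Rightarrow> real ^ 'm)"
  unfolding bilinear_conv_bounded_bilinear [symmetric] bilinear_def
  by (auto intro!: linearI simp: matrix_vector_mult_def vec_eq_iff sum.distrib sum_distrib_left algebra_simps)

lemma levi_civita_metric:
  assumes "pseudo_riemannian g"
  shows "metric_connection g (levi_civita g)"
  unfolding metric_connection_def
proof (intro allI impI, elim conjE)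
  fix X Y Z :: "'a vfield" and P
  assume s: "smooth_on UNIV X" "smooth_on UNIV Y" "smooth_on UNIV Z"
  note dY = smooth_has_derivative[OF s(2), of P] and dZ = smooth_has_derivative[OF s(3), of P]
  note dg = metric_has_derivative[OF assms, of P]
  let ?G = "\<lambda>u v. (\<chi> k. \<Sum>i\<in>UNIV. \<Sum>j\<in>UNIV. christoffel g P k i j * u $ i * v $ j)"
  have gs: "transpose (g P) = g P" using assms by (simp add: pseudo_riemannian_def)
  have "((\<lambda>p. form (g p) (Y p) (Z p)) has_derivative
     (\<lambda>v. form (g P) (Y P) (frechet_derivative Z (at P) v) + form (frechet_derivative g (at P) v) (Y P) (Z P)
        + form (g P) (frechet_derivative Y (at P) v) (Z P))) (at P)"
    unfolding form_def
    by (rule has_derivative_eq_rhs, rule has_derivative_inner[OF dY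
        bounded_bilinear.FDERIV[OF bounded_bilinear_matrix_vector_mult dg dZ]])
      (simp add: inner_add_right)
  from frechet_derivative_at[OF this, symmetric]
  have "frechet_derivative (\<lambda>p. form (g p) (Y p) (Z p)) (at P) (X P) =
     form (g P) (Y P) (frechet_derivative Z (at P) (X P)) + form (frechet_derivative g (at P) (X P)) (Y P) (Z P)
        + form (g P) (frechet_derivative Y (at P) (X P)) (Z P)"
    by (rule fun_cong)
  moreover have "form (frechet_derivative g (at P) (X P)) (Y P) (Z P) =
     form (g P) (?G (X P) (Y P)) (Z P) + form (g P) (Y P) (?G (X P) (Z P))"
    unfolding form_sym[OF gs, of "Y P" "?G (X P) (Z P)"] form_christoffel[OF assms]
    using form_metric_derivative_sym[OF assms, of P "X P" "Z P" "Y P"] by argo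
  ultimately show "frechet_derivative (\<lambda>p. form (g p) (Y p) (Z p)) (at P) (X P)
      = form (g P) (levi_civita g X Y P) (Z P) + form (g P) (Y P) (levi_civita g X Z P)"
    by (simp add: levi_civita_def form_add_left form_add_right)
qed

theorem levi_civita_characterization:
  assumes "pseudo_riemannian g"
  shows "affine_connection (levi_civita g)" "torsion_free (levi_civita g)"
    "metric_connection g (levi_civita g)"
    and "torsion_free D \<Longrightarrow> metric_connection g D \<Longrightarrow> smooth_on UNIV X \<Longrightarrow> smooth_on UNIV Y
      \<Longrightarrow> D X Y = levi_civita g X Y"
proof -
  note tm = levi_civita_torsion_free[OF assms] levi_civita_metric[OF assms]
  show "affine_connection (levi_civita g)" "torsion_free (levi_civita g)"
    "metric_connection g (levi_civita g)"
    by (rule levi_civita_affine tm)+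
  assume D: "torsion_free D" "metric_connection g D" and XY: "smooth_on UNIV X" "smooth_on UNIV Y"
  show "D X Y = levi_civita g X Y"
    by (rule ext) (rule koszul_unique[OF assms D tm XY])
qed

subsection \<open>\<open>metric_h h\<close> is pseudo-Riemannian\<close>

lemma Ck_on_compose_nth:
  fixes b :: "'b::real_normed_vector"
  assumes "Ck_on k UNIV (h :: real \<Rightarrow> real)"
  shows "Ck_on k UNIV (\<lambda>P :: real ^ 'n. a + h (P $ i) *\<^sub>R b)"
  using assms
proof (induction k arbitrary: h a b)
  case 0
  then have "continuous_on UNIV h" by simp
  then have "continuous_on UNIV (\<lambda>P :: real ^ 'n. h (P $ i))"
    by (rule continuous_on_compose2) (auto intro: continuous_on_component)
  then show ?case by (auto intro!: continuous_intros)
next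
  case (Suc k)
  have d: "((\<lambda>P :: real ^ 'n. a + h (P $ i) *\<^sub>R b) has_derivative
      (\<lambda>v. frechet_derivative h (at (P $ i)) (v $ i) *\<^sub>R b)) (at P)" for P
  proof -
    have "(h has_derivative frechet_derivative h (at (P $ i))) (at (P $ i))"
      using Suc.prems frechet_derivative_works by auto
    from has_derivative_compose[OF bounded_linear_imp_has_derivative[OF bounded_linear_vec_nth] this]
    have "((\<lambda>P :: real ^ 'n. h (P $ i)) has_derivative
      (\<lambda>v. frechet_derivative h (at (P $ i)) (v $ i))) (at P)" .
    from has_derivative_add[OF has_derivative_const has_derivative_scaleR_left[OF this]]
    show ?thesis by simp
  qed
  have "Ck_on k UNIV (\<lambda>P :: real ^ 'n. 0 + frechet_derivative h (at (P $ i)) (v $ i) *\<^sub>R b)" for v :: "real ^ 'n"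
    by (rule Suc.IH[of "\<lambda>t. frechet_derivative h (at t) (v $ i)"]) (use Suc.prems in auto)
  then show ?case
    unfolding Ck_on.simps frechet_derivative_at[OF d, symmetric] differentiable_def
    using d by auto
qed

lemma pseudo_riemannian_metric_h:
  assumes "smooth_on UNIV h"
  shows "pseudo_riemannian (metric_h h)"
proof -
  define a :: "real ^ 3 ^ 3" where "a = vector [vector [1, 0, 0], vector [0, 0, 1], vector [0, 1, 0]]"
  define b :: "real ^ 3 ^ 3" where "b = vector [0, vector [0, - 2, 0], 0]"
  have "metric_h h = (\<lambda>P. a + h (P $ 1) *\<^sub>R b)"
    by (rule ext) (simp add: metric_h_def a_def b_def vec_eq_iff forall_3)
  then have "smooth_on UNIV (metric_h h)"
    using assms Ck_on_compose_nth[of _ h a "1 :: 3" b] by (simp add: smooth_on_def)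
  moreover have "transpose (metric_h h P) = metric_h h P" for P
    by (simp add: metric_h_def vec_eq_iff forall_3 transpose_def)
  moreover have "det (metric_h h P) = - 1" for P
    by (simp add: metric_h_def det_3)
  ultimately show ?thesis by (simp add: pseudo_riemannian_def invertible_det_nz)
qed

end

theory Submission
  imports Defs
begin

text \<open>
  The form \<open>dx\<close> is parallel and \<open>\<nabla>dt = - h' dx \<otimes> dx\<close>, so \<open>dt \<and> dx\<close> is parallel and
  \<open>R\<close>, \<open>\<nabla>R\<close>, \<open>\<nabla>\<^sup>2R\<close> are, up to sign, the square of \<open>dt \<and> dx\<close> tensored with \<open>h''\<close>, \<open>h''' dt\<close> and
  \<open>h'''' dt \<otimes> dt - h''' h' dx \<otimes> dx\<close> respectively.  Isometries
  with \<open>dt \<mapsto> dt\<close>, \<open>dx \<mapsto> \<alpha> dx\<close> then give \<open>CH\<^sub>0\<close>, and the extra dilation factor gives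
  \<open>SCH\<^sub>1(1,3)\<close>.  Conversely, an isometry compatible with \<open>R\<close> and \<open>\<nabla>R\<close> maps \<open>dt\<close> to \<open>\<plusminus>dt\<close> if \<open>h''' \<noteq> 0\<close>,
  which makes \<open>(h'''/h'')\<^sup>2\<close> an invariant; for local isometries \<open>\<phi>\<close> this is read off directly from the
  second-derivative equations of the components of \<open>\<phi>\<close>.  \<open>SCH\<^sub>2(1,3)\<close> forces
  \<open>h' h''' / (h'')\<^sup>2\<close> to be constant, that is, \<open>h'/h''\<close> to be affine in \<open>t\<close>; having no zero, it is constant,
  so that \<open>h = A e\<^bsup>\<kappa>t\<^esup> + C\<close>.  For such \<open>h\<close> there are even affine isometries acting transitively.
\<close>

subsection \<open>Derivatives of functions of one variable\<close>

lemma smooth_has_real_derivative: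
  assumes "smooth_on UNIV (h :: real \<Rightarrow> real)"
  shows "(h has_real_derivative deriv h t) (at t)"
  using smooth_on_differentiable[OF assms, of t]
  by (simp add: DERIV_deriv_iff_real_differentiable)

lemma smooth_on_deriv:
  assumes "smooth_on UNIV (h :: real \<Rightarrow> real)"
  shows "smooth_on UNIV (deriv h)"
proof -
  have "deriv h = (\<lambda>t. frechet_derivative h (at t) 1)"
    using frechet_derivative_at[OF smooth_has_real_derivative[OF assms, unfolded has_field_derivative_def]]
    by (metis mult_cancel_left1 mult.commute)
  moreover have "Ck_on k UNIV (\<lambda>t. frechet_derivative h (at t) 1)" for k
    using assms Ck_on.simps(2)[of k UNIV h] by (metis smooth_on_def)
  ultimately show ?thesis by (simp add: smooth_on_def)
qed

lemma smooth_on_higher_deriv: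
  "smooth_on UNIV (h :: real \<Rightarrow> real) \<Longrightarrow> smooth_on UNIV ((deriv ^^ k) h)"
  by (induction k) (auto intro: smooth_on_deriv)

lemma higher_deriv_has_derivative:
  assumes "smooth_on UNIV (h :: real \<Rightarrow> real)"
  shows "((deriv ^^ k) h has_real_derivative (deriv ^^ Suc k) h t) (at t)"
  using smooth_has_real_derivative[OF smooth_on_higher_deriv[OF assms]] by simp

lemma second_deriv_has_real_derivative:
  assumes "smooth_on UNIV (h :: real \<Rightarrow> real)"
  shows "(deriv h has_real_derivative (deriv ^^ 2) h t) (at t)"
    and "((deriv ^^ 2) h has_real_derivative (deriv ^^ 3) h t) (at t)"
  using higher_deriv_has_derivative[OF assms, of 1 t] higher_deriv_has_derivative[OF assms, of 2 t]
  by (simp_all add: eval_nat_numeral)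

text \<open>The range of a continuous function on the line is connected, so it cannot take both
  signs while missing 0. Ratios of h'' and of h''' at two points are therefore positive, which makes
  the boost and dilation factors built from them real and positive.\<close>

lemma nonzero_same_sign:
  assumes "continuous_on UNIV (f :: real \<Rightarrow> real)" "\<And>t. f t \<noteq> 0"
  shows "f s / f t > 0"
proof (rule ccontr)
  assume "\<not> ?thesis"
  then have "(f s < 0 \<and> f t > 0) \<or> (f s > 0 \<and> f t < 0)"
    using assms(2)[of s] assms(2)[of t] by (auto simp: not_less zero_less_divide_iff)
  moreover have "connected (range f)"
    by (rule connected_continuous_image[OF assms(1)]) simp
  ultimately have "0 \<in> range f"
    unfolding connected_iff_interval by (metis less_imp_le rangeI)
  then show False using assms(2) by force
qed

lemma smooth_nonzero_same_sign:
  assumes "smooth_on UNIV (h :: real \<Rightarrow> real)" "\<forall>t. (deriv ^^ k) h t \<noteq> 0"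
  shows "(deriv ^^ k) h s / (deriv ^^ k) h t > 0"
proof (rule nonzero_same_sign[where f = "(deriv ^^ k) h"])
  show "continuous_on UNIV ((deriv ^^ k) h)"
    using smooth_on_higher_deriv[OF assms(1), of k] by (metis Ck_on.simps(1) smooth_on_def)
qed (use assms in blast)

text \<open>On constant arguments every tensor of the curvature computation is a function of t alone
  times a constant, and this is the rule that differentiates it.\<close>

lemma has_derivative_nth_scaleR:
  fixes c :: "'b::real_normed_vector"
  assumes "(f has_real_derivative f') (at (P $ i))"
  shows "((\<lambda>p :: real ^ 'n. f (p $ i) *\<^sub>R c) has_derivative (\<lambda>v. (f' * v $ i) *\<^sub>R c)) (at P)"
proof -
  have "((\<lambda>p :: real ^ 'n. p $ i) has_derivative (\<lambda>v. v $ i)) (at P)"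
    by (rule bounded_linear_imp_has_derivative[OF bounded_linear_vec_nth])
  from has_derivative_compose[OF this assms[unfolded has_field_derivative_def]]
  show ?thesis by (rule has_derivative_scaleR_left)
qed

lemmas frechet_nth_scaleR = frechet_derivative_at[OF has_derivative_nth_scaleR, symmetric]

subsection \<open>The curvature of \<open>metric_h h\<close>\<close>

lemma form_metric_h:
  "form (metric_h h P) u v = u $ 1 * v $ 1 + u $ 2 * v $ 3 + u $ 3 * v $ 2 - 2 * h (P $ 1) * u $ 2 * v $ 2"
  by (simp add: form_sum sum_3 metric_h_def algebra_simps)

lemma matrix_inv_metric_h:
  "matrix_inv (metric_h h P) = vector [vector [1, 0, 0], vector [0, 0, 1], vector [0, 1, 2 * h (P $ 1)]]"
  (is "_ = ?B")
proof -
  have i: "metric_h h P ** ?B = mat 1" "?B ** metric_h h P = mat 1"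
    by (simp_all add: metric_h_def matrix_matrix_mult_def vec_eq_iff forall_3 sum_3 mat_def)
  \<comment> \<open>\<open>matrix_inv\<close> is a choice of some two-sided inverse; uniqueness of
    inverses then identifies the chosen one with \<open>?B\<close>.\<close>
  then have "metric_h h P ** matrix_inv (metric_h h P) = mat 1 \<and> matrix_inv (metric_h h P) ** metric_h h P = mat 1"
    unfolding matrix_inv_def by (intro someI_ex[of "\<lambda>A'. metric_h h P ** A' = mat 1 \<and> A' ** metric_h h P = mat 1"]) auto
  then have "matrix_inv (metric_h h P) ** (metric_h h P ** ?B) = ?B"
    by (simp only: matrix_mul_assoc matrix_mul_lid)
  then show ?thesis
    by (simp only: i matrix_mul_rid)
qed

lemma frechet_derivative_metric_h:
  assumes "smooth_on UNIV h"
  shows "frechet_derivative (metric_h h) (at P) v $ i $ j =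
    (if i = 2 \<and> j = 2 then - 2 * deriv h (P $ 1) * v $ 1 else 0)"
proof -
  define a :: "real ^ 3 ^ 3" where "a = vector [vector [1, 0, 0], vector [0, 0, 1], vector [0, 1, 0]]"
  define b :: "real ^ 3 ^ 3" where "b = vector [0, vector [0, - 2, 0], 0]"
  have e: "metric_h h = (\<lambda>P. a + h (P $ 1) *\<^sub>R b)"
    by (rule ext) (simp add: metric_h_def a_def b_def vec_eq_iff forall_3)
  have "(metric_h h has_derivative (\<lambda>v. 0 + (deriv h (P $ 1) * v $ 1) *\<^sub>R b)) (at P)"
    unfolding e by (intro has_derivative_add has_derivative_const
      has_derivative_nth_scaleR smooth_has_real_derivative assms)
  from frechet_derivative_at[OF this, symmetric]
  have "frechet_derivative (metric_h h) (at P) v = (deriv h (P $ 1) * v $ 1) *\<^sub>R b" by simp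
  then show ?thesis
    using exhaust_3[of i] exhaust_3[of j] by (auto simp: b_def)
qed

text \<open>The nonzero covariant derivatives of the coordinate fields are h' \<partial>t for the
  pair (x,x) and - h' \<partial>y for the pair (t,x). With the common factor h' split off, the
  remaining bilinear map depends neither on the point nor on h.\<close>

definition christoffel_map :: "real ^ 3 \<Rightarrow> real ^ 3 \<Rightarrow> real ^ 3" where
  "christoffel_map u v = vector [u $ 2 * v $ 2, 0, - (u $ 1 * v $ 2 + u $ 2 * v $ 1)]"

lemma levi_civita_metric_h:
  assumes "smooth_on UNIV h"
  shows "levi_civita (metric_h h) X Y P =
    frechet_derivative Y (at P) (X P) + deriv h (P $ 1) *\<^sub>R christoffel_map (X P) (Y P)"
proof -
  have "(\<chi> k. \<Sum>i\<in>UNIV. \<Sum>j\<in>UNIV. christoffel (metric_h h) P k i j * u $ i * v $ j)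
      = deriv h (P $ 1) *\<^sub>R christoffel_map u v" for u v
    unfolding vec_eq_iff forall_3 christoffel_def Let_def frechet_derivative_metric_h[OF assms] matrix_inv_metric_h
    by (simp add: sum_3 axis_def christoffel_map_def algebra_simps)
  then show ?thesis by (simp add: levi_civita_def)
qed

definition area_form :: "real ^ 3 \<Rightarrow> real ^ 3 \<Rightarrow> real" where
  "area_form u v = u $ 1 * v $ 2 - u $ 2 * v $ 1"

text \<open>The skew-adjoint endomorphism that the metric associates with dt \<and> dx: the inner
  product of \<open>null_rotation w\<close> and z is \<open>area_form z w\<close>. It is nilpotent,
  and its components are constant although the metric varies.\<close>

definition null_rotation :: "real ^ 3 \<Rightarrow> real ^ 3" where
  "null_rotation w = vector [w $ 2, 0, - w $ 1]"

context
  fixes h :: "real \<Rightarrow> real"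
  assumes h: "smooth_on UNIV h"
begin

lemma levi_civita_const:
  "levi_civita (metric_h h) (\<lambda>_. u) (\<lambda>_. v) = (\<lambda>P. deriv h (P $ 1) *\<^sub>R christoffel_map u v)"
  by (rule ext) (simp add: levi_civita_metric_h[OF h])

lemma levi_civita_nth_scaleR:
  assumes "(f has_real_derivative f') (at (P $ 1))"
  shows "levi_civita (metric_h h) (\<lambda>_. u) (\<lambda>p. f (p $ 1) *\<^sub>R c) P =
    (f' * u $ 1) *\<^sub>R c + (deriv h (P $ 1) * f (P $ 1)) *\<^sub>R christoffel_map u c"
  unfolding levi_civita_metric_h[OF h] frechet_nth_scaleR[OF assms]
  by (simp add: christoffel_map_def vec_eq_iff forall_3 algebra_simps)

lemma lie_bracket_const: "lie_bracket (\<lambda>_. u) (\<lambda>_. v) = (\<lambda>_. 0)"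
  by (rule ext) (simp add: lie_bracket_def)

text \<open>The terms quadratic in h' cancel, since
  \<open>christoffel_map u (christoffel_map v w)\<close> is symmetric in u and v. Only the
  derivative of the factor h' survives.\<close>

lemma curv_op_metric_h:
  "curv_op (metric_h h) P [u, v, w] = ((deriv ^^ 2) h (P $ 1) * area_form u v) *\<^sub>R null_rotation w"
proof -
  have d: "(deriv h has_real_derivative (deriv ^^ 2) h (P $ 1)) (at (P $ 1))"
    using higher_deriv_has_derivative[OF h, of 1 "P $ 1"] by (simp add: eval_nat_numeral)
  show ?thesis
    unfolding curv_op_def curvature_def lie_bracket_const levi_civita_const
    by (simp add: levi_civita_nth_scaleR[OF d] levi_civita_const)
      (simp add: christoffel_map_def null_rotation_def area_form_def vec_eq_iff forall_3 algebra_simps)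
qed

text \<open>\<open>area_form\<close> and \<open>null_rotation\<close> are parallel, so the h'
  corrections cancel and only the factor h'' is differentiated.\<close>

lemma nabla_curv_op_1:
  "nabla_curv_op 1 (metric_h h) P [u, v, w, a] = ((deriv ^^ 3) h (P $ 1) * (area_form u v * a $ 1)) *\<^sub>R null_rotation w"
proof -
  have d: "((deriv ^^ 2) h has_real_derivative (deriv ^^ 3) h (P $ 1)) (at (P $ 1))"
    using higher_deriv_has_derivative[OF h, of 2 "P $ 1"] by (simp add: eval_nat_numeral)
  have "{..<3::nat} = {0, 1, 2}" by auto
  then show ?thesis
    by (simp add: nabla_curv_op_def cov_deriv1_def curv_op_metric_h levi_civita_const
        levi_civita_nth_scaleR[OF d] flip: scaleR_scaleR)
      (simp add: christoffel_map_def null_rotation_def area_form_def vec_eq_iff forall_3 algebra_simps)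
qed

text \<open>The slot \<open>a\<close> carries dt, which is not parallel: its correction by
  \<open>christoffel_map\<close> is what adds the term with h''' h'.\<close>

lemma nabla_curv_op_2:
  "nabla_curv_op 2 (metric_h h) P [u, v, w, a, b] =
    (((deriv ^^ 4) h (P $ 1) * a $ 1 * b $ 1 - (deriv ^^ 3) h (P $ 1) * deriv h (P $ 1) * a $ 2 * b $ 2) * area_form u v) *\<^sub>R null_rotation w"
proof -
  have d: "((deriv ^^ 3) h has_real_derivative (deriv ^^ 4) h (P $ 1)) (at (P $ 1))"
    using higher_deriv_has_derivative[OF h, of 3 "P $ 1"] by (simp add: eval_nat_numeral)
  have s: "{..<4::nat} = {0, 1, 2, 3}" by auto
  have "nabla_curv_op 2 (metric_h h) = cov_deriv1 (levi_civita (metric_h h)) (nabla_curv_op 1 (metric_h h))"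
    by (simp add: nabla_curv_op_def numeral_2_eq_2)
  then show ?thesis
    by (simp add: s cov_deriv1_def nabla_curv_op_1 levi_civita_const
        levi_civita_nth_scaleR[OF d] del: One_nat_def flip: scaleR_scaleR)
      (simp add: christoffel_map_def null_rotation_def area_form_def vec_eq_iff forall_3 algebra_simps)
qed

lemma curv_tensor_metric_h:
  "curv_tensor (metric_h h) P [u, v, w, z] = ((deriv ^^ 2) h (P $ 1) * (area_form u v * area_form z w))"
  by (simp add: curv_tensor_def curv_op_metric_h form_metric_h)
    (simp add: null_rotation_def area_form_def algebra_simps)

lemma nabla_curv_tensor_1:
  "nabla_curv_tensor 1 (metric_h h) P [u, v, w, z, a] = (deriv ^^ 3) h (P $ 1) * (area_form u v * area_form z w * a $ 1)"
proof -
  have d: "((deriv ^^ 2) h has_real_derivative (deriv ^^ 3) h (P $ 1)) (at (P $ 1))"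
    using higher_deriv_has_derivative[OF h, of 2 "P $ 1"] by (simp add: eval_nat_numeral)
  have s: "{..<4::nat} = {0, 1, 2, 3}" by auto
  show ?thesis
    by (simp add: s nabla_curv_tensor_def cov_deriv0_def curv_tensor_metric_h levi_civita_const
        frechet_nth_scaleR[OF d, where 'b = real, simplified])
      (simp add: christoffel_map_def area_form_def algebra_simps)
qed

lemma nabla_curv_tensor_2:
  "nabla_curv_tensor 2 (metric_h h) P [u, v, w, z, a, b] =
    ((deriv ^^ 4) h (P $ 1) * a $ 1 * b $ 1 - (deriv ^^ 3) h (P $ 1) * deriv h (P $ 1) * a $ 2 * b $ 2) * (area_form u v * area_form z w)"
proof -
  have d: "((deriv ^^ 3) h has_real_derivative (deriv ^^ 4) h (P $ 1)) (at (P $ 1))"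
    using higher_deriv_has_derivative[OF h, of 3 "P $ 1"] by (simp add: eval_nat_numeral)
  have s: "{..<5::nat} = {0, 1, 2, 3, 4}" by auto
  have "nabla_curv_tensor 2 (metric_h h) = cov_deriv0 (levi_civita (metric_h h)) (nabla_curv_tensor 1 (metric_h h))"
    by (simp add: nabla_curv_tensor_def numeral_2_eq_2)
  then show ?thesis
    by (simp add: s cov_deriv0_def nabla_curv_tensor_1 levi_civita_const
        frechet_nth_scaleR[OF d, where 'b = real, simplified] del: One_nat_def)
      (simp add: christoffel_map_def area_form_def algebra_simps)
qed

end

subsection \<open>Directional derivatives\<close>

text \<open>The direction comes first, so that \<open>dir_deriv v\<close> is an operator on
  functions that can be iterated, in step with the recursion of \<open>Ck_on\<close>.\<close>

definition dir_deriv :: "'a::real_normed_vector \<Rightarrow> ('a \<Rightarrow> 'b::real_normed_vector) \<Rightarrow> 'a \<Rightarrow> 'b" where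
  "dir_deriv v f p = frechet_derivative f (at p) v"

lemma dir_deriv_eqI: "(f has_derivative f') (at p) \<Longrightarrow> dir_deriv v f p = f' v"
  using frechet_derivative_at by (metis dir_deriv_def)

lemma smooth_on_dir_deriv: "smooth_on U f \<Longrightarrow> smooth_on U (dir_deriv v f)"
  unfolding dir_deriv_def smooth_on_def using Ck_on.simps(2) by metis

lemma smooth_on_has_derivative:
  "smooth_on U f \<Longrightarrow> p \<in> U \<Longrightarrow> (f has_derivative (\<lambda>v. dir_deriv v f p)) (at p)"
  unfolding dir_deriv_def by (rule iffD1[OF frechet_derivative_works smooth_on_differentiable])

lemma smooth_on_imp_continuous_on: "smooth_on U f \<Longrightarrow> continuous_on U f"
  unfolding smooth_on_def by (metis Ck_on.simps(1))

text \<open>The tool for differentiating an identity that is known only on an open set.\<close>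

lemma derivative_eq_on_open:
  assumes "open U" "p \<in> U" "\<And>q. q \<in> U \<Longrightarrow> f q = g q"
    and "(f has_derivative f') (at p)" "(g has_derivative g') (at p)"
  shows "f' v = g' v"
  using has_derivative_unique[OF has_derivative_transform_within_open[OF assms(4,1,2,3)] assms(5)] by simp

lemma Ck_on_cong:
  assumes "open U" "Ck_on k U f" "\<And>q. q \<in> U \<Longrightarrow> f q = g q"
  shows "Ck_on k U g"
  using assms(2,3)
proof (induction k arbitrary: f g)
  case 0
  then show ?case using continuous_on_cong by force
next
  case (Suc k)
  have d: "(g has_derivative frechet_derivative f (at x)) (at x)" if "x \<in> U" for x
    by (rule has_derivative_transform_within_open[OF iffD1[OF frechet_derivative_works] assms(1)])
      (use Suc.prems that in auto)
  have "Ck_on k U (\<lambda>x. frechet_derivative g (at x) v)" for v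
  proof (rule Suc.IH)
    show "Ck_on k U (\<lambda>x. frechet_derivative f (at x) v)"
      using Suc.prems by simp
    show "frechet_derivative f (at x) v = frechet_derivative g (at x) v" if "x \<in> U" for x
      using fun_cong[OF frechet_derivative_at[OF d[OF that]]] .
  qed
  then show ?case using d by (auto simp: differentiable_def)
qed

lemma Ck_on_bounded_linear:
  assumes "open U" "bounded_linear L" "Ck_on k U f"
  shows "Ck_on k U (\<lambda>p. L (f p))"
  using assms(3)
proof (induction k arbitrary: f)
  case 0
  then show ?case using bounded_linear.continuous_on[OF assms(2)] by simp
next
  case (Suc k)
  have d: "((\<lambda>p. L (f p)) has_derivative (\<lambda>v. L (frechet_derivative f (at x) v))) (at x)" if "x \<in> U" for x
    by (rule bounded_linear.has_derivative[OF assms(2) iffD1[OF frechet_derivative_works]])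
      (use Suc.prems that in auto)
  have "Ck_on k U (\<lambda>x. frechet_derivative (\<lambda>p. L (f p)) (at x) v)" for v
  proof (rule Ck_on_cong[OF assms(1)])
    show "Ck_on k U (\<lambda>x. L (frechet_derivative f (at x) v))"
      using Suc by simp
    show "L (frechet_derivative f (at x) v) = frechet_derivative (\<lambda>p. L (f p)) (at x) v" if "x \<in> U" for x
      using fun_cong[OF frechet_derivative_at[OF d[OF that]]] .
  qed
  then show ?case using d by (auto simp: differentiable_def)
qed

lemma smooth_on_bounded_linear:
  "open U \<Longrightarrow> bounded_linear L \<Longrightarrow> smooth_on U f \<Longrightarrow> smooth_on U (\<lambda>p. L (f p))"
  by (simp add: smooth_on_def Ck_on_bounded_linear)

section \<open>Symmetry of mixed second derivatives\<close>

lemma has_real_derivative_along_line: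
  assumes "smooth_on U (f :: 'a::real_normed_vector \<Rightarrow> real)" "y + a *\<^sub>R u \<in> U"
  shows "((\<lambda>a. f (y + a *\<^sub>R u)) has_real_derivative dir_deriv u f (y + a *\<^sub>R u)) (at a)"
proof -
  have D: "(f has_derivative (\<lambda>v. dir_deriv v f (y + a *\<^sub>R u))) (at (y + a *\<^sub>R u))"
    by (rule smooth_on_has_derivative[OF assms])
  have "((\<lambda>a. y + a *\<^sub>R u) has_derivative (\<lambda>s. s *\<^sub>R u)) (at a)"
    by (auto intro!: derivative_eq_intros)
  from has_derivative_compose[OF this D]
  have "((\<lambda>a. f (y + a *\<^sub>R u)) has_derivative (\<lambda>s. dir_deriv (s *\<^sub>R u) f (y + a *\<^sub>R u))) (at a)" .
  then show ?thesis
    unfolding has_field_derivative_def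
    by (rule has_derivative_eq_rhs) (simp add: fun_eq_iff linear_cmul[OF has_derivative_linear[OF D]])
qed

text \<open>The mean value theorem is used twice, first along u and then along v. The bound on s
  keeps the whole parallelogram inside the ball, where f is smooth.\<close>

lemma second_difference:
  assumes f: "smooth_on U (f :: 'a::real_normed_vector \<Rightarrow> real)" and "ball x r \<subseteq> U"
    and s: "s > 0" "s * (norm u + norm v) < r"
  shows "\<exists>a\<in>{0..s}. \<exists>b\<in>{0..s}. f (x + s *\<^sub>R u + s *\<^sub>R v) - f (x + s *\<^sub>R u) - f (x + s *\<^sub>R v) + f x
    = s * s * dir_deriv v (dir_deriv u f) (x + a *\<^sub>R u + b *\<^sub>R v)"
proof -
  have U: "x + a *\<^sub>R u + b *\<^sub>R v \<in> U" if "a \<in> {0..s}" "b \<in> {0..s}" for a b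
  proof -
    have "norm (a *\<^sub>R u + b *\<^sub>R v) \<le> a * norm u + b * norm v"
      using that norm_triangle_ineq[of "a *\<^sub>R u" "b *\<^sub>R v"] by simp
    also have "\<dots> \<le> s * norm u + s * norm v"
      using that by (intro add_mono mult_right_mono) auto
    also have "\<dots> < r" using s by (simp add: algebra_simps)
    finally have "dist (x + a *\<^sub>R u + b *\<^sub>R v) x < r"
      by (simp add: dist_norm)
    then show ?thesis using assms(2) by (auto simp: dist_commute)
  qed
  \<comment> \<open>The second difference is \<open>g s - g 0\<close>, where \<open>g\<close> is the
    difference across the v-side of the parallelogram.\<close>
  define g where "g a = f (x + s *\<^sub>R v + a *\<^sub>R u) - f (x + a *\<^sub>R u)" for a
  have "(g has_real_derivative dir_deriv u f (x + s *\<^sub>R v + a *\<^sub>R u) - dir_deriv u f (x + a *\<^sub>R u)) (at a)"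
    if "a \<in> {0..s}" for a
    unfolding g_def using U[OF that, of 0] U[OF that, of s] s
    by (intro DERIV_diff has_real_derivative_along_line[OF f]) (auto simp: algebra_simps)
  then obtain a where a: "0 < a" "a < s"
    "g s - g 0 = (s - 0) * (dir_deriv u f (x + s *\<^sub>R v + a *\<^sub>R u) - dir_deriv u f (x + a *\<^sub>R u))"
    using MVT2[OF s(1), of g "\<lambda>a. dir_deriv u f (x + s *\<^sub>R v + a *\<^sub>R u) - dir_deriv u f (x + a *\<^sub>R u)"] by auto
  define k where "k b = dir_deriv u f (x + a *\<^sub>R u + b *\<^sub>R v)" for b
  have "(k has_real_derivative dir_deriv v (dir_deriv u f) (x + a *\<^sub>R u + b *\<^sub>R v)) (at b)"
    if "b \<in> {0..s}" for b
    unfolding k_def using U[OF _ that, of a] a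
    by (intro has_real_derivative_along_line[OF smooth_on_dir_deriv[OF f]]) auto
  then obtain b where b: "0 < b" "b < s" "k s - k 0 = (s - 0) * dir_deriv v (dir_deriv u f) (x + a *\<^sub>R u + b *\<^sub>R v)"
    using MVT2[OF s(1), of k "\<lambda>b. dir_deriv v (dir_deriv u f) (x + a *\<^sub>R u + b *\<^sub>R v)"] by auto
  have "g s - g 0 = s * (k s - k 0)"
    using a(3) by (simp add: k_def algebra_simps)
  then have "g s - g 0 = s * s * dir_deriv v (dir_deriv u f) (x + a *\<^sub>R u + b *\<^sub>R v)"
    using b(3) by simp
  then show ?thesis using a b by (intro bexI[of _ a] bexI[of _ b]) (auto simp: g_def algebra_simps)
qed

text \<open>The mean value theorem, applied to both orders of the second difference, shows that the mixed
  derivatives agree at points arbitrarily close to \<open>x\<close>.\<close>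

theorem dir_deriv_commute:
  assumes U: "open U" "x \<in> U" and f: "smooth_on U (f :: 'a::real_normed_vector \<Rightarrow> real)"
  shows "dir_deriv u (dir_deriv v f) x = dir_deriv v (dir_deriv u f) x"
proof (rule ccontr)
  let ?G = "dir_deriv u (dir_deriv v f)" and ?H = "dir_deriv v (dir_deriv u f)"
  assume ne: "?G x \<noteq> ?H x"
  \<comment> \<open>Half the gap: a common value within \<open>e\<close> of both \<open>?G x\<close>
    and \<open>?H x\<close> would make the gap smaller than itself.\<close>
  define e where "e = \<bar>?G x - ?H x\<bar> / 2"
  have e: "e > 0" using ne by (simp add: e_def)
  obtain r where r: "r > 0" "ball x r \<subseteq> U" using U open_contains_ball by blast
  have "isCont ?G x" "isCont ?H x"
    using U smooth_on_imp_continuous_on[OF smooth_on_dir_deriv[OF smooth_on_dir_deriv[OF f]]] continuous_on_eq_continuous_at by blast+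
  then have "\<exists>d>0. \<forall>y. dist y x < d \<longrightarrow> dist (?G y) (?G x) < e"
      "\<exists>d>0. \<forall>y. dist y x < d \<longrightarrow> dist (?H y) (?H x) < e"
    unfolding continuous_at_eps_delta using e by (simp_all only:)
  then obtain d1 d2 where d: "d1 > 0" "\<And>y. dist y x < d1 \<Longrightarrow> dist (?G y) (?G x) < e"
      "d2 > 0" "\<And>y. dist y x < d2 \<Longrightarrow> dist (?H y) (?H x) < e"
    by blast
  define m where "m = min r (min d1 d2)"
  have m: "m > 0" using r d by (simp add: m_def)
  \<comment> \<open>The summand 1 keeps the denominator positive when u = v = 0; parallelograms of
    this scale stay within distance m of x.\<close>
  define s where "s = m / (2 * (norm u + norm v + 1))"
  have pos: "norm u + norm v + 1 > 0" using norm_ge_zero[of u] norm_ge_zero[of v] by linarith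
  have s0: "s > 0" using m pos by (simp add: s_def)
  have s1: "s * (norm u + norm v) < m"
  proof -
    have "s * (norm u + norm v) \<le> s * (norm u + norm v + 1)" using s0 by simp
    also have "\<dots> = m / 2" using pos by (simp add: s_def field_simps)
    finally show ?thesis using m by simp
  qed
  have near: "dist (x + a *\<^sub>R u' + b *\<^sub>R v') x < m"
    if "a \<in> {0..s}" "b \<in> {0..s}" "norm u' + norm v' = norm u + norm v" for a b u' v'
  proof -
    have "dist (x + a *\<^sub>R u' + b *\<^sub>R v') x \<le> a * norm u' + b * norm v'"
      using that norm_triangle_ineq[of "a *\<^sub>R u'" "b *\<^sub>R v'"] by (simp add: dist_norm)
    also have "\<dots> \<le> s * norm u' + s * norm v'"
      using that by (intro add_mono mult_right_mono) auto
    also have "\<dots> = s * (norm u + norm v)" using that by (simp flip: distrib_left)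
    finally show ?thesis using s1 by simp
  qed
  have s1': "s * (norm u + norm v) < r" "s * (norm v + norm u) < r"
    using s1 by (simp_all add: m_def add.commute)
  obtain a b where ab: "a \<in> {0..s}" "b \<in> {0..s}"
    "f (x + s *\<^sub>R u + s *\<^sub>R v) - f (x + s *\<^sub>R u) - f (x + s *\<^sub>R v) + f x = s * s * ?H (x + a *\<^sub>R u + b *\<^sub>R v)"
    using second_difference[OF f r(2) s0 s1'(1)] by blast
  obtain a' b' where ab': "a' \<in> {0..s}" "b' \<in> {0..s}"
    "f (x + s *\<^sub>R v + s *\<^sub>R u) - f (x + s *\<^sub>R v) - f (x + s *\<^sub>R u) + f x = s * s * ?G (x + a' *\<^sub>R v + b' *\<^sub>R u)"
    using second_difference[OF f r(2) s0 s1'(2)] by blast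
  have sw: "x + s *\<^sub>R v + s *\<^sub>R u = x + s *\<^sub>R u + s *\<^sub>R v" by simp
  have "s * s * ?H (x + a *\<^sub>R u + b *\<^sub>R v) = s * s * ?G (x + a' *\<^sub>R v + b' *\<^sub>R u)"
    using ab(3) ab'(3) unfolding sw by linarith
  then have "?H (x + a *\<^sub>R u + b *\<^sub>R v) = ?G (x + a' *\<^sub>R v + b' *\<^sub>R u)"
    using s0 by simp
  moreover have "dist (?H (x + a *\<^sub>R u + b *\<^sub>R v)) (?H x) < e"
    by (rule d(4)) (use near[OF ab(1,2), of u v] in \<open>simp add: m_def\<close>)
  moreover have "dist (?G (x + a' *\<^sub>R v + b' *\<^sub>R u)) (?G x) < e"
    by (rule d(2)) (use near[OF ab'(1,2), of v u] in \<open>simp add: m_def add.commute\<close>)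
  ultimately have "dist (?G x) (?H x) < e + e"
    using dist_triangle3[of "?G x" "?H x" "?H (x + a *\<^sub>R u + b *\<^sub>R v)"] by simp
  then show False by (simp add: e_def dist_real_def)
qed

lemma has_derivative_comp_real:
  assumes "(k has_real_derivative k') (at (f p))" "(f has_derivative f') (at p)"
  shows "((\<lambda>p. k (f p)) has_derivative (\<lambda>w. k' * f' w)) (at p)"
  using has_derivative_compose[OF assms(2) assms(1)[unfolded has_field_derivative_def]] .

subsection \<open>Local isometries\<close>

locale metric_h_isometry =
  fixes h k :: "real \<Rightarrow> real" and U :: "(real ^ 3) set" and \<phi> :: "real ^ 3 \<Rightarrow> real ^ 3"
  assumes h: "smooth_on UNIV h" and k: "smooth_on UNIV k"
    and U: "open U" and \<phi>: "smooth_on U \<phi>"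
    and iso: "p \<in> U \<Longrightarrow> linear_isometry (metric_h h p) (metric_h k (\<phi> p)) (frechet_derivative \<phi> (at p))"
begin

abbreviation "T \<equiv> \<lambda>p. \<phi> p $ 1"
abbreviation "X \<equiv> \<lambda>p. \<phi> p $ 2"
abbreviation "Y \<equiv> \<lambda>p. \<phi> p $ 3"

lemma smooth_component: "smooth_on U (\<lambda>p. \<phi> p $ i)"
  by (rule smooth_on_bounded_linear[OF U bounded_linear_vec_nth \<phi>])

lemma dir_deriv_component: "p \<in> U \<Longrightarrow> dir_deriv u (\<lambda>p. \<phi> p $ i) p = frechet_derivative \<phi> (at p) u $ i"
  using dir_deriv_eqI[OF bounded_linear.has_derivative[OF bounded_linear_vec_nth smooth_on_has_derivative[OF \<phi>]]]
  by (simp add: dir_deriv_def)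

lemma comm: "p \<in> U \<Longrightarrow> dir_deriv u (dir_deriv v (\<lambda>p. \<phi> p $ i)) p = dir_deriv v (dir_deriv u (\<lambda>p. \<phi> p $ i)) p"
  by (rule dir_deriv_commute[OF U _ smooth_component])

lemma isometry_eq:
  assumes "p \<in> U"
  shows "dir_deriv u T p * dir_deriv v T p + dir_deriv u X p * dir_deriv v Y p + dir_deriv u Y p * dir_deriv v X p
      - 2 * k (T p) * dir_deriv u X p * dir_deriv v X p
    = u $ 1 * v $ 1 + u $ 2 * v $ 3 + u $ 3 * v $ 2 - 2 * h (p $ 1) * u $ 2 * v $ 2"
  using iso[OF assms] form_metric_h[of h p u v] assms
    form_metric_h[of k "\<phi> p" "frechet_derivative \<phi> (at p) u" "frechet_derivative \<phi> (at p) v"]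
  by (simp add: linear_isometry_def dir_deriv_component)

lemma isometry_surj:
  fixes a :: "real ^ 3"
  assumes "p \<in> U"
  obtains w where "dir_deriv w T p = a $ 1" "dir_deriv w X p = a $ 2" "dir_deriv w Y p = a $ 3"
proof -
  obtain w where "frechet_derivative \<phi> (at p) w = a"
    using iso[OF assms] unfolding linear_isometry_def by (metis bij_pointE)
  then show ?thesis using that[of w] dir_deriv_component[OF assms] by simp
qed

lemma has_derivative_coord: "((\<lambda>p. (p :: real ^ 3) $ i) has_derivative (\<lambda>v. v $ i)) (at p)"
  by (rule bounded_linear_imp_has_derivative[OF bounded_linear_vec_nth])

lemma isometry_eq_derivative:
  assumes p: "p \<in> U"
  shows "dir_deriv w (dir_deriv u T) p * dir_deriv v T p + dir_deriv u T p * dir_deriv w (dir_deriv v T) p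
     + dir_deriv w (dir_deriv u X) p * dir_deriv v Y p + dir_deriv u X p * dir_deriv w (dir_deriv v Y) p
     + dir_deriv w (dir_deriv u Y) p * dir_deriv v X p + dir_deriv u Y p * dir_deriv w (dir_deriv v X) p
     - 2 * deriv k (T p) * dir_deriv w T p * dir_deriv u X p * dir_deriv v X p
     - 2 * k (T p) * (dir_deriv w (dir_deriv u X) p * dir_deriv v X p + dir_deriv u X p * dir_deriv w (dir_deriv v X) p)
    = - 2 * deriv h (p $ 1) * w $ 1 * u $ 2 * v $ 2"
proof -
  note D = smooth_on_has_derivative[OF smooth_on_dir_deriv[OF smooth_component] p]
  have K: "((\<lambda>p. k (T p)) has_derivative (\<lambda>w. deriv k (T p) * dir_deriv w T p)) (at p)"
    by (rule has_derivative_comp_real[OF smooth_has_real_derivative[OF k] smooth_on_has_derivative[OF smooth_component p]])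
  have H: "((\<lambda>p. h (p $ 1)) has_derivative (\<lambda>w. deriv h (p $ 1) * w $ 1)) (at p)"
    by (rule has_derivative_comp_real[OF smooth_has_real_derivative[OF h] has_derivative_coord])
  have L: "((\<lambda>p. dir_deriv u T p * dir_deriv v T p + dir_deriv u X p * dir_deriv v Y p + dir_deriv u Y p * dir_deriv v X p
      - 2 * k (T p) * dir_deriv u X p * dir_deriv v X p) has_derivative
    (\<lambda>w. dir_deriv w (dir_deriv u T) p * dir_deriv v T p + dir_deriv u T p * dir_deriv w (dir_deriv v T) p
     + dir_deriv w (dir_deriv u X) p * dir_deriv v Y p + dir_deriv u X p * dir_deriv w (dir_deriv v Y) p
     + dir_deriv w (dir_deriv u Y) p * dir_deriv v X p + dir_deriv u Y p * dir_deriv w (dir_deriv v X) p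
     - 2 * deriv k (T p) * dir_deriv w T p * dir_deriv u X p * dir_deriv v X p
     - 2 * k (T p) * (dir_deriv w (dir_deriv u X) p * dir_deriv v X p + dir_deriv u X p * dir_deriv w (dir_deriv v X) p))) (at p)"
    by (rule derivative_eq_intros D K refl)+ (simp add: fun_eq_iff algebra_simps)
  have R: "((\<lambda>p. u $ 1 * v $ 1 + u $ 2 * v $ 3 + u $ 3 * v $ 2 - 2 * h (p $ 1) * u $ 2 * v $ 2) has_derivative
    (\<lambda>w. - 2 * deriv h (p $ 1) * w $ 1 * u $ 2 * v $ 2)) (at p)"
    by (rule derivative_eq_intros H refl)+ (simp add: fun_eq_iff algebra_simps)
  show ?thesis
    by (rule derivative_eq_on_open[OF U p isometry_eq L R])
qed

text \<open>As in the Koszul formula, the cyclic combination of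
  \<open>isometry_eq_derivative\<close> (first two instances minus the third) is twice this
  identity. By symmetry of second derivatives only those in directions u, v remain. It says that
  \<phi> respects the two Levi-Civita connections.\<close>

lemma koszul:
  assumes p: "p \<in> U"
  shows "dir_deriv u (dir_deriv v T) p * dir_deriv w T p + dir_deriv u (dir_deriv v X) p * dir_deriv w Y p + dir_deriv u (dir_deriv v Y) p * dir_deriv w X p
     - 2 * k (T p) * dir_deriv u (dir_deriv v X) p * dir_deriv w X p
     - deriv k (T p) * (dir_deriv v T p * dir_deriv u X p * dir_deriv w X p + dir_deriv u T p * dir_deriv v X p * dir_deriv w X p
         - dir_deriv w T p * dir_deriv u X p * dir_deriv v X p)
    = - deriv h (p $ 1) * (v $ 1 * u $ 2 * w $ 2 + u $ 1 * v $ 2 * w $ 2 - w $ 1 * u $ 2 * v $ 2)"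
  using isometry_eq_derivative[OF p, of u v w] isometry_eq_derivative[OF p, of v u w]
    isometry_eq_derivative[OF p, of w u v]
  unfolding comm[OF p, of w u] comm[OF p, of w v] comm[OF p, of v u]
  by (simp add: algebra_simps)

text \<open>The Koszul identity is solved for a component of the second derivative of \<open>\<phi>\<close> by choosing \<open>w\<close>
  such that its image is the metric dual of that component.\<close>

lemma second_derivative_X:
  assumes p: "p \<in> U"
  shows "dir_deriv u (dir_deriv v X) p = - deriv h (p $ 1) *
     ((v $ 1 * u $ 2 + u $ 1 * v $ 2) * dir_deriv (axis 3 1) X p - u $ 2 * v $ 2 * dir_deriv (axis 1 1) X p)"
proof -
  obtain w where w: "dir_deriv w T p = 0" "dir_deriv w X p = 0" "dir_deriv w Y p = 1"
    using isometry_surj[OF p, of "axis 3 1"] by (auto simp: axis_def)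
  \<comment> \<open>The image of \<open>w\<close> is \<partial>y, and pairing with \<partial>y is
    dx. So \<open>w\<close> pairs with a source vector a to give dX(a), and a = \<partial>y,
    \<partial>t yield the two components of \<open>w\<close>.\<close>
  have "w $ 2 = dir_deriv (axis 3 1) X p" "w $ 1 = dir_deriv (axis 1 1) X p"
    using isometry_eq[OF p, of w "axis 3 1"] isometry_eq[OF p, of w "axis 1 1"] w by (simp_all add: axis_def)
  then show ?thesis using koszul[OF p, of u v w] w by (simp add: algebra_simps)
qed

text \<open>Here the dual vector is \<partial>t. Unlike the X-component, the T-component of the
  target connection is nonzero, which leaves the term with \<open>deriv k\<close>.\<close>

lemma second_derivative_T:
  assumes p: "p \<in> U"
  shows "dir_deriv u (dir_deriv v T) p + deriv k (T p) * dir_deriv u X p * dir_deriv v X p = - deriv h (p $ 1) *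
     ((v $ 1 * u $ 2 + u $ 1 * v $ 2) * dir_deriv (axis 3 1) T p - u $ 2 * v $ 2 * dir_deriv (axis 1 1) T p)"
proof -
  obtain w where w: "dir_deriv w T p = 1" "dir_deriv w X p = 0" "dir_deriv w Y p = 0"
    using isometry_surj[OF p, of "axis 1 1"] by (auto simp: axis_def)
  have "w $ 2 = dir_deriv (axis 3 1) T p" "w $ 1 = dir_deriv (axis 1 1) T p"
    using isometry_eq[OF p, of w "axis 3 1"] isometry_eq[OF p, of w "axis 1 1"] w by (simp_all add: axis_def)
  then show ?thesis using koszul[OF p, of u v w] w by (simp add: algebra_simps)
qed

end

lemma dir_deriv_eq_on_open:
  assumes "open U" "p \<in> U" "smooth_on U f" "\<And>q. q \<in> U \<Longrightarrow> f q = g q" "(g has_derivative g') (at p)"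
  shows "dir_deriv v f p = g' v"
  by (rule derivative_eq_on_open[OF assms(1,2,4) smooth_on_has_derivative[OF assms(3,2)] assms(5)])

context metric_h_isometry
begin

text \<open>On basis vectors the second-derivative equations have this shape: a function of t times
  a first derivative, valid on \<open>U\<close>.\<close>

lemma dir_deriv_coord_mult:
  assumes "p \<in> U" "smooth_on U f" "smooth_on U F" "(g has_real_derivative g') (at (p $ 1))"
    and "\<And>q. q \<in> U \<Longrightarrow> f q = g (q $ 1) * F q"
  shows "dir_deriv w f p = g' * w $ 1 * F p + g (p $ 1) * dir_deriv w F p"
proof -
  have "((\<lambda>q. g (q $ 1)) has_derivative (\<lambda>w. g' * w $ 1)) (at p)"
    by (rule has_derivative_comp_real[OF assms(4) has_derivative_coord])
  from has_derivative_mult[OF this smooth_on_has_derivative[OF assms(3,1)]]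
  show ?thesis
    using dir_deriv_eq_on_open[OF U assms(1,2,5)] by (simp add: algebra_simps)
qed

section \<open>Rigidity of local isometries where h'' has no zero\<close>

context
  assumes h2: "(deriv ^^ 2) h t \<noteq> 0"
begin

abbreviation "e1 \<equiv> axis 1 1 :: real ^ 3"
abbreviation "e2 \<equiv> axis 2 1 :: real ^ 3"
abbreviation "e3 \<equiv> axis 3 1 :: real ^ 3"

lemmas smooth_dir_deriv_component = smooth_on_dir_deriv[OF smooth_component]

text \<open>Equality of the mixed second derivatives of \<open>dir_deriv e2 X\<close> says that the curvature annihilates the parallel form \<open>dX\<close>.\<close>

lemma dX_e1: "p \<in> U \<Longrightarrow> dir_deriv e1 X p = 0"
proof -
  assume p: "p \<in> U"
  have a: "dir_deriv e1 (dir_deriv e2 (dir_deriv e2 X)) p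
     = (deriv ^^ 2) h (p $ 1) * e1 $ 1 * dir_deriv e1 X p + deriv h (p $ 1) * dir_deriv e1 (dir_deriv e1 X) p"
    by (rule dir_deriv_coord_mult[OF p smooth_on_dir_deriv[OF smooth_dir_deriv_component] smooth_dir_deriv_component second_deriv_has_real_derivative(1)[OF h]])
      (simp add: second_derivative_X axis_def)
  have b: "dir_deriv e2 (dir_deriv e1 (dir_deriv e2 X)) p
     = - (deriv ^^ 2) h (p $ 1) * e2 $ 1 * dir_deriv e3 X p + - deriv h (p $ 1) * dir_deriv e2 (dir_deriv e3 X) p"
    by (rule dir_deriv_coord_mult[OF p smooth_on_dir_deriv[OF smooth_dir_deriv_component] smooth_dir_deriv_component DERIV_minus[OF second_deriv_has_real_derivative(1)[OF h]]])
      (simp add: second_derivative_X axis_def)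
  show ?thesis
    using a b dir_deriv_commute[OF U p smooth_dir_deriv_component[of e2 2], of e1 e2] h2 second_derivative_X[OF p, of _ e1] second_derivative_X[OF p, of _ e3]
    by (simp add: axis_def)
qed

text \<open>Differentiating \<open>dX_e1\<close> gives h' dX(\<partial>y) = 0 on \<open>U\<close>,
  but h' may vanish at p. One more derivative along t replaces h' by h'', as dX(\<partial>y) has
  zero derivative.\<close>

lemma dX_e3: "p \<in> U \<Longrightarrow> dir_deriv e3 X p = 0"
proof -
  assume p: "p \<in> U"
  have z: "0 = - deriv h (q $ 1) * dir_deriv e3 X q" if q: "q \<in> U" for q
  proof -
    have "dir_deriv e2 (dir_deriv e1 X) q = 0"
      by (rule dir_deriv_eq_on_open[OF U q smooth_dir_deriv_component _ has_derivative_const]) (simp add: dX_e1)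
    then show ?thesis using second_derivative_X[OF q, of e2 e1] by (simp add: axis_def)
  qed
  have "dir_deriv e1 (\<lambda>_. 0) p = - (deriv ^^ 2) h (p $ 1) * e1 $ 1 * dir_deriv e3 X p + - deriv h (p $ 1) * dir_deriv e1 (dir_deriv e3 X) p"
    by (rule dir_deriv_coord_mult[OF p smooth_on_const smooth_dir_deriv_component DERIV_minus[OF second_deriv_has_real_derivative(1)[OF h]] z])
  then show ?thesis
    using h2 second_derivative_X[OF p, of _ e3] by (simp add: axis_def dir_deriv_def)
qed

lemma dX_e2_const: "p \<in> U \<Longrightarrow> dir_deriv u (dir_deriv e2 X) p = 0"
  using second_derivative_X[of p u e2] dX_e1[of p] dX_e3[of p] by simp

text \<open>Now dX is a multiple of dx. Since \<partial>y is null, dT(\<partial>y) = 0; pairing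
  \<partial>x with \<partial>y then shows that the multiple is not 0, and pairing \<partial>t with
  itself gives dT(\<partial>t).\<close>

lemma dX_e2_nonzero: "p \<in> U \<Longrightarrow> dir_deriv e2 X p \<noteq> 0"
  and dT_e1: "p \<in> U \<Longrightarrow> (dir_deriv e1 T p)\<^sup>2 = 1"
  using isometry_eq[of p e3 e3] isometry_eq[of p e2 e3] isometry_eq[of p e1 e1] dX_e1[of p] dX_e3[of p]
  by (auto simp: axis_def power2_eq_square)

lemma dT_e1_const: "p \<in> U \<Longrightarrow> dir_deriv u (dir_deriv e1 T) p = 0"
proof -
  assume p: "p \<in> U"
  note D = smooth_on_has_derivative[OF smooth_dir_deriv_component p]
  have "((\<lambda>q. (dir_deriv e1 T q)\<^sup>2) has_derivative (\<lambda>u. 2 * (dir_deriv e1 T p * dir_deriv u (dir_deriv e1 T) p))) (at p)"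
    by (rule derivative_eq_intros D refl)+ (simp add: fun_eq_iff)
  from derivative_eq_on_open[OF U p dT_e1 this has_derivative_const, of u]
  show ?thesis using dT_e1[OF p] by auto
qed

text \<open>Differentiate the \<open>(x,x)\<close> second-derivative equation of \<open>T\<close> along \<open>t\<close>.\<close>

lemma deriv2_relation:
  assumes p: "p \<in> U"
  shows "(deriv ^^ 2) k (T p) * (dir_deriv e2 X p)\<^sup>2 = (deriv ^^ 2) h (p $ 1)"
proof -
  \<comment> \<open>Moving \<open>e1\<close> innermost reduces this to
    \<open>dT_e1_const\<close>.\<close>
  have z: "dir_deriv e1 (dir_deriv e2 (dir_deriv e2 T)) p = 0"
  proof -
    have "dir_deriv e1 (dir_deriv e2 T) q = 0" if "q \<in> U" for q
      using comm[OF that, of e1 e2 1] dT_e1_const[OF that, of e2] by simp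
    then have "dir_deriv e2 (dir_deriv e1 (dir_deriv e2 T)) p = 0"
      by (intro dir_deriv_eq_on_open[OF U p smooth_on_dir_deriv[OF smooth_dir_deriv_component] _ has_derivative_const]) simp
    then show ?thesis using dir_deriv_commute[OF U p smooth_dir_deriv_component[of e2 1], of e1 e2] by simp
  qed
  have e: "dir_deriv e2 (dir_deriv e2 T) q + deriv k (T q) * (dir_deriv e2 X q)\<^sup>2 = deriv h (q $ 1) * dir_deriv e1 T q"
    if "q \<in> U" for q
    using second_derivative_T[OF that, of e2 e2] by (simp add: axis_def power2_eq_square mult.assoc)
  note D = smooth_on_has_derivative[OF smooth_dir_deriv_component p] smooth_on_has_derivative[OF smooth_on_dir_deriv[OF smooth_dir_deriv_component] p]
  have K: "((\<lambda>p. deriv k (T p)) has_derivative (\<lambda>w. (deriv ^^ 2) k (T p) * dir_deriv w T p)) (at p)"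
    by (rule has_derivative_comp_real[OF second_deriv_has_real_derivative(1)[OF k] smooth_on_has_derivative[OF smooth_component p]])
  have H: "((\<lambda>p. deriv h (p $ 1)) has_derivative (\<lambda>w. (deriv ^^ 2) h (p $ 1) * w $ 1)) (at p)"
    by (rule has_derivative_comp_real[OF second_deriv_has_real_derivative(1)[OF h] has_derivative_coord])
  have L: "((\<lambda>q. dir_deriv e2 (dir_deriv e2 T) q + deriv k (T q) * (dir_deriv e2 X q)\<^sup>2) has_derivative
     (\<lambda>w. dir_deriv w (dir_deriv e2 (dir_deriv e2 T)) p + (deriv ^^ 2) k (T p) * dir_deriv w T p * (dir_deriv e2 X p)\<^sup>2)) (at p)"
    by (rule derivative_eq_intros D K refl)+ (simp add: fun_eq_iff dX_e2_const[OF p])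
  have R: "((\<lambda>q. deriv h (q $ 1) * dir_deriv e1 T q) has_derivative
     (\<lambda>w. (deriv ^^ 2) h (p $ 1) * w $ 1 * dir_deriv e1 T p)) (at p)"
    by (rule derivative_eq_intros D H refl)+ (simp add: fun_eq_iff dT_e1_const[OF p])
  show ?thesis
    using derivative_eq_on_open[OF U p e L R, of e1] z dT_e1[OF p] by (auto simp: axis_def)
qed

text \<open>Another derivative along t, with \<open>dir_deriv e2 X\<close> constant. Dividing by
  \<open>deriv2_relation\<close> gives h'''/h'' = \<plusminus> k'''/k'', hence equal
  squares.\<close>

lemma deriv3_relation:
  assumes p: "p \<in> U"
  shows "(deriv ^^ 3) k (T p) * dir_deriv e1 T p * (dir_deriv e2 X p)\<^sup>2 = (deriv ^^ 3) h (p $ 1)"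
proof -
  note D = smooth_on_has_derivative[OF smooth_dir_deriv_component p]
  have K: "((\<lambda>p. (deriv ^^ 2) k (T p)) has_derivative (\<lambda>w. (deriv ^^ 3) k (T p) * dir_deriv w T p)) (at p)"
    by (rule has_derivative_comp_real[OF second_deriv_has_real_derivative(2)[OF k] smooth_on_has_derivative[OF smooth_component p]])
  have H: "((\<lambda>p. (deriv ^^ 2) h (p $ 1)) has_derivative (\<lambda>w. (deriv ^^ 3) h (p $ 1) * w $ 1)) (at p)"
    by (rule has_derivative_comp_real[OF second_deriv_has_real_derivative(2)[OF h] has_derivative_coord])
  have L: "((\<lambda>q. (deriv ^^ 2) k (T q) * (dir_deriv e2 X q)\<^sup>2) has_derivative
     (\<lambda>w. (deriv ^^ 3) k (T p) * dir_deriv w T p * (dir_deriv e2 X p)\<^sup>2)) (at p)"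
    by (rule derivative_eq_intros D K refl)+ (simp add: fun_eq_iff dX_e2_const[OF p])
  show ?thesis
    using derivative_eq_on_open[OF U p deriv2_relation L H, of e1] by (simp add: axis_def)
qed

lemma invariant_eq:
  assumes p: "p \<in> U"
  shows "((deriv ^^ 3) h (p $ 1) / (deriv ^^ 2) h (p $ 1))\<^sup>2 = ((deriv ^^ 3) k (T p) / (deriv ^^ 2) k (T p))\<^sup>2"
  unfolding deriv2_relation[OF p, symmetric] deriv3_relation[OF p, symmetric]
  using dX_e2_nonzero[OF p] dT_e1[OF p] by (simp add: power_mult_distrib power_divide)

end

end

theorem isometry_invariant_ratio:
  "isometry_invariant (\<lambda>h. smooth_on UNIV h \<and> (\<forall>t. (deriv ^^ 2) h t \<noteq> 0))
    (\<lambda>h P. ((deriv ^^ 3) h (P $ 1) / (deriv ^^ 2) h (P $ 1))\<^sup>2)"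
  unfolding isometry_invariant_def
proof (intro allI impI, elim conjE)
  fix h k :: "real \<Rightarrow> real" and P Q :: "real ^ 3"
  assume s: "smooth_on UNIV h" "smooth_on UNIV k" and n: "\<forall>t. (deriv ^^ 2) h t \<noteq> 0"
    and "locally_isometric_at (metric_h h) P (metric_h k) Q"
  then obtain U \<phi> where *: "open U" "P \<in> U" "\<phi> P = Q" "smooth_on U \<phi>"
    "\<forall>p\<in>U. linear_isometry (metric_h h p) (metric_h k (\<phi> p)) (frechet_derivative \<phi> (at p))"
    unfolding locally_isometric_at_def by blast
  interpret metric_h_isometry h k U \<phi>
    by standard (use s * in auto)
  show "((deriv ^^ 3) h (P $ 1) / (deriv ^^ 2) h (P $ 1))\<^sup>2 = ((deriv ^^ 3) k (Q $ 1) / (deriv ^^ 2) k (Q $ 1))\<^sup>2"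
    using invariant_eq[OF n[rule_format] *(2)] *(3) by simp
qed

subsection \<open>Curvature homogeneity\<close>

text \<open>Preserves dt and multiplies dx by \<alpha>; the factor 1/\<alpha> on \<partial>y keeps
  the pairing of \<partial>x and \<partial>y, and the shear \<beta> adjusts the length of the image
  of \<partial>x.\<close>

definition boost :: "real \<Rightarrow> real \<Rightarrow> real ^ 3 \<Rightarrow> real ^ 3" where
  "boost \<alpha> \<beta> u = vector [u $ 1, \<alpha> * u $ 2, u $ 3 / \<alpha> + \<beta> * u $ 2]"

lemma boost_nth [simp]:
  "boost \<alpha> \<beta> u $ 1 = u $ 1" "boost \<alpha> \<beta> u $ 2 = \<alpha> * u $ 2" "boost \<alpha> \<beta> u $ 3 = u $ 3 / \<alpha> + \<beta> * u $ 2"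
  by (simp_all add: boost_def)

lemma linear_boost: "linear (boost \<alpha> \<beta>)"
  by (rule linearI) (simp_all add: vec_eq_iff forall_3 algebra_simps add_divide_distrib)

lemma boost_inverse: "\<alpha> \<noteq> 0 \<Longrightarrow> boost (1 / \<alpha>) (- \<beta>) (boost \<alpha> \<beta> u) = u"
  and boost_inverse': "\<alpha> \<noteq> 0 \<Longrightarrow> boost \<alpha> \<beta> (boost (1 / \<alpha>) (- \<beta>) u) = u"
  by (simp_all add: vec_eq_iff forall_3 field_simps)

lemma bij_boost: "\<alpha> \<noteq> 0 \<Longrightarrow> bij (boost \<alpha> \<beta>)"
  by (rule o_bij[of "boost (1 / \<alpha>) (- \<beta>)"]) (simp_all add: fun_eq_iff boost_inverse boost_inverse')

lemma area_form_boost: "area_form (boost \<alpha> \<beta> u) (boost \<alpha> \<beta> v) = \<alpha> * area_form u v"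
  by (simp add: area_form_def algebra_simps)

lemma null_rotation_boost: "\<alpha> \<noteq> 0 \<Longrightarrow> null_rotation (boost \<alpha> \<beta> u) = \<alpha> *\<^sub>R boost \<alpha> \<beta> (null_rotation u)"
  by (simp add: null_rotation_def vec_eq_iff forall_3)

lemma area_form_scaleR: "area_form (c *\<^sub>R u) (d *\<^sub>R v) = c * d * area_form u v"
  by (simp add: area_form_def algebra_simps)

lemma null_rotation_scaleR: "null_rotation (c *\<^sub>R u) = c *\<^sub>R null_rotation u"
  by (simp add: null_rotation_def vec_eq_iff forall_3)

text \<open>The second assumption compares the squared length of \<partial>x with that of its image.
  For one pair of points it can always be solved for \<beta>; solving it with one \<beta> for all
  points is a functional equation on h and k.\<close>

lemma linear_isometry_boost:
  assumes "\<alpha> \<noteq> 0" "\<alpha> * \<beta> = k (Q $ 1) * \<alpha>\<^sup>2 - h (P $ 1)"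
  shows "linear_isometry (metric_h h P) (metric_h k Q) (boost \<alpha> \<beta>)"
  unfolding linear_isometry_def
proof (intro conjI allI linear_boost bij_boost assms(1))
  fix u v
  have "form (metric_h k Q) (boost \<alpha> \<beta> u) (boost \<alpha> \<beta> v) = u $ 1 * v $ 1 + u $ 2 * v $ 3 + u $ 3 * v $ 2
    + 2 * (\<alpha> * \<beta> - k (Q $ 1) * \<alpha>\<^sup>2) * u $ 2 * v $ 2"
    using assms(1) by (simp add: form_metric_h field_simps power2_eq_square)
  then show "form (metric_h k Q) (boost \<alpha> \<beta> u) (boost \<alpha> \<beta> v) = form (metric_h h P) u v"
    unfolding assms(2) by (simp add: form_metric_h algebra_simps)
qed

lemma ex_linear_isometry_boost:
  assumes "\<alpha> \<noteq> 0"
  obtains \<beta> where "linear_isometry (metric_h h P) (metric_h k Q) (boost \<alpha> \<beta>)"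
  by (rule that[OF linear_isometry_boost[OF assms, of "(k (Q $ 1) * \<alpha>\<^sup>2 - h (P $ 1)) / \<alpha>"]]) (use assms in simp)

lemma length_3_plusE:
  assumes "length vs = 3 + k" "k \<le> 2"
  obtains u v w where "k = 0" "vs = [u, v, w]"
  | u v w a where "k = 1" "vs = [u, v, w, a]"
  | u v w a b where "k = 2" "vs = [u, v, w, a, b]"
proof -
  have "k = 0 \<or> k = 1 \<or> k = 2" using assms by auto
  then show ?thesis using assms(1) that
    by (auto simp: eval_nat_numeral length_Suc_conv)
qed

lemma length_4_plusE:
  assumes "length vs = 4 + k" "k \<le> 2"
  obtains u v w z where "k = 0" "vs = [u, v, w, z]"
  | u v w z a where "k = 1" "vs = [u, v, w, z, a]"
  | u v w z a b where "k = 2" "vs = [u, v, w, z, a, b]"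
proof -
  have "k = 0 \<or> k = 1 \<or> k = 2" using assms by auto
  then show ?thesis using assms(1) that
    by (auto simp: eval_nat_numeral length_Suc_conv)
qed

context
  fixes h :: "real \<Rightarrow> real"
  assumes h: "smooth_on UNIV h"
begin

lemma nabla_curv_tensor_0:
  "nabla_curv_tensor 0 (metric_h h) P [u, v, w, z] = (deriv ^^ 2) h (P $ 1) * (area_form u v * area_form z w)"
  by (simp add: nabla_curv_tensor_def curv_tensor_metric_h[OF h])

lemma nabla_curv_op_0:
  "nabla_curv_op 0 (metric_h h) P [u, v, w] = ((deriv ^^ 2) h (P $ 1) * area_form u v) *\<^sub>R null_rotation w"
  by (simp add: nabla_curv_op_def curv_op_metric_h[OF h])

text \<open>A boost multiplies each \<open>area_form\<close> and each dx by \<alpha> and fixes dt.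
  So the dt terms scale by \<alpha> squared, and the dx-dx term of the second covariant derivative
  by the fourth power.\<close>

lemma curvature_homogeneousI:
  assumes "r \<le> 2"
    and "\<And>(P :: real ^ 3) (Q :: real ^ 3). \<exists>\<alpha>. \<alpha> \<noteq> 0 \<and> (deriv ^^ 2) h (Q $ 1) * \<alpha>\<^sup>2 = (deriv ^^ 2) h (P $ 1)
      \<and> (r \<ge> 1 \<longrightarrow> (deriv ^^ 3) h (Q $ 1) * \<alpha>\<^sup>2 = (deriv ^^ 3) h (P $ 1))
      \<and> (r \<ge> 2 \<longrightarrow> (deriv ^^ 4) h (Q $ 1) * \<alpha>\<^sup>2 = (deriv ^^ 4) h (P $ 1)
           \<and> (deriv ^^ 3) h (Q $ 1) * deriv h (Q $ 1) * \<alpha> ^ 4 = (deriv ^^ 3) h (P $ 1) * deriv h (P $ 1))"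
  shows "curvature_homogeneous r (metric_h h)"
  unfolding curvature_homogeneous_def
proof (intro allI)
  fix P Q :: "real ^ 3"
  obtain \<alpha> where \<alpha>: "\<alpha> \<noteq> 0" "(deriv ^^ 2) h (P $ 1) = (deriv ^^ 2) h (Q $ 1) * \<alpha>\<^sup>2"
      "r \<ge> 1 \<Longrightarrow> (deriv ^^ 3) h (P $ 1) = (deriv ^^ 3) h (Q $ 1) * \<alpha>\<^sup>2"
      "r \<ge> 2 \<Longrightarrow> (deriv ^^ 4) h (P $ 1) = (deriv ^^ 4) h (Q $ 1) * \<alpha>\<^sup>2"
      "r \<ge> 2 \<Longrightarrow> (deriv ^^ 3) h (P $ 1) * deriv h (P $ 1) = (deriv ^^ 3) h (Q $ 1) * deriv h (Q $ 1) * \<alpha> ^ 4"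
    using assms(2)[of Q P] by metis
  obtain \<beta> where F: "linear_isometry (metric_h h P) (metric_h h Q) (boost \<alpha> \<beta>)"
    using ex_linear_isometry_boost[OF \<alpha>(1)] by blast
  have "nabla_curv_tensor k (metric_h h) Q (map (boost \<alpha> \<beta>) vs) = nabla_curv_tensor k (metric_h h) P vs"
    if k: "k \<le> r" and l: "length vs = 4 + k" for k vs
  proof (rule length_4_plusE[OF l])
    show "k \<le> 2" using k assms(1) by simp
  next
    fix u v w z assume "k = 0" "vs = [u, v, w, z]"
    then show ?thesis by (simp add: nabla_curv_tensor_0 area_form_boost \<alpha>(2) power2_eq_square)
  next
    fix u v w z a assume e: "k = 1" "vs = [u, v, w, z, a]"
    have "r \<ge> 1" using e k by simp
    with e show ?thesis
      by (simp add: nabla_curv_tensor_1[OF h] area_form_boost \<alpha>(3) power2_eq_square del: One_nat_def)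
  next
    fix u v w z a b assume e: "k = 2" "vs = [u, v, w, z, a, b]"
    have r: "r \<ge> 2" using e k by simp
    show ?thesis
      unfolding e list.map nabla_curv_tensor_2[OF h] \<alpha>(4,5)[OF r] area_form_boost boost_nth
      by (simp add: algebra_simps power2_eq_square power4_eq_xxxx)
  qed
  with F show "\<exists>F. linear_isometry (metric_h h P) (metric_h h Q) F \<and>
       (\<forall>k\<le>r. \<forall>vs. length vs = 4 + k \<longrightarrow>
          nabla_curv_tensor k (metric_h h) Q (map F vs) = nabla_curv_tensor k (metric_h h) P vs)" by blast
qed

lemma curvature_homogeneous_0:
  assumes h2: "\<forall>t. (deriv ^^ 2) h t \<noteq> 0"
  shows "curvature_homogeneous 0 (metric_h h)"
proof (rule curvature_homogeneousI)
  fix P Q :: "real ^ 3"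
  define x where "x = (deriv ^^ 2) h (P $ 1) / (deriv ^^ 2) h (Q $ 1)"
  have "x > 0" unfolding x_def by (rule smooth_nonzero_same_sign[OF h h2])
  then have "sqrt x \<noteq> 0" "(deriv ^^ 2) h (Q $ 1) * (sqrt x)\<^sup>2 = (deriv ^^ 2) h (P $ 1)"
    using h2 by (simp_all, simp add: x_def)
  then show "\<exists>\<alpha>. \<alpha> \<noteq> 0 \<and> (deriv ^^ 2) h (Q $ 1) * \<alpha>\<^sup>2 = (deriv ^^ 2) h (P $ 1)
      \<and> ((0 :: nat) \<ge> 1 \<longrightarrow> (deriv ^^ 3) h (Q $ 1) * \<alpha>\<^sup>2 = (deriv ^^ 3) h (P $ 1))
      \<and> ((0 :: nat) \<ge> 2 \<longrightarrow> (deriv ^^ 4) h (Q $ 1) * \<alpha>\<^sup>2 = (deriv ^^ 4) h (P $ 1)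
           \<and> (deriv ^^ 3) h (Q $ 1) * deriv h (Q $ 1) * \<alpha> ^ 4 = (deriv ^^ 3) h (P $ 1) * deriv h (P $ 1))"
    by (intro exI[of _ "sqrt x"]) simp
qed simp

lemma strongly_curvature_homogeneous_1:
  assumes "\<forall>t. (deriv ^^ 2) h t \<noteq> 0" "\<forall>t. (deriv ^^ 3) h t \<noteq> 0"
  shows "strongly_curvature_homogeneous_13 1 (metric_h h)"
  unfolding strongly_curvature_homogeneous_13_def
proof (intro allI)
  fix P Q :: "real ^ 3"
  define x2 where "x2 = (deriv ^^ 2) h (P $ 1) / (deriv ^^ 2) h (Q $ 1)"
  define x3 where "x3 = (deriv ^^ 3) h (P $ 1) / (deriv ^^ 3) h (Q $ 1)"
  have x: "x2 > 0" "x3 > 0"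
    using smooth_nonzero_same_sign[OF h] assms by (auto simp: x2_def x3_def)
  \<comment> \<open>For H = c times a boost, pulling back R multiplies by c^2 \<alpha>^2 and pulling
    back its first covariant derivative by c^3 \<alpha>^2. The values of \<open>c\<close> and
    \<open>\<alpha>\<close> solve c^2 \<alpha>^2 = x2 and c^3 \<alpha>^2 = x3.\<close>
  define c where "c = x3 / x2"
  define \<alpha> where "\<alpha> = sqrt x2 / c"
  have c: "c > 0" using x by (simp add: c_def)
  have \<alpha>: "\<alpha> > 0" "c\<^sup>2 * \<alpha>\<^sup>2 = x2" using x c by (simp_all add: \<alpha>_def power_divide)
  have "c ^ 3 * \<alpha>\<^sup>2 = c * (c\<^sup>2 * \<alpha>\<^sup>2)" by (simp add: eval_nat_numeral)
  then have x3: "c ^ 3 * \<alpha>\<^sup>2 = x3" using x \<alpha>(2) by (simp add: c_def)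
  have h2: "(deriv ^^ 2) h (P $ 1) = (deriv ^^ 2) h (Q $ 1) * (c\<^sup>2 * \<alpha>\<^sup>2)"
    using assms \<alpha>(2) by (simp add: x2_def)
  have h3: "(deriv ^^ 3) h (P $ 1) = (deriv ^^ 3) h (Q $ 1) * (c ^ 3 * \<alpha>\<^sup>2)"
    using assms x3 by (simp add: x3_def)
  obtain \<beta> where F: "linear_isometry (metric_h h P) (metric_h h Q) (boost \<alpha> \<beta>)"
    using ex_linear_isometry_boost[of \<alpha>] \<alpha> by (metis less_irrefl)
  define H where "H u = c *\<^sub>R boost \<alpha> \<beta> u" for u
  have hom: "homothety (metric_h h P) (metric_h h Q) H"
    unfolding homothety_def H_def using c F by blast
  have "inv H y = x" if "y = H x" for x y
  proof -
    have "inj H" using bij_boost[of \<alpha> \<beta>] \<alpha> c unfolding H_def by (auto simp: inj_def bij_def)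
    then show ?thesis using that by simp
  qed
  moreover have "nabla_curv_op k (metric_h h) Q (map H vs) = H (nabla_curv_op k (metric_h h) P vs)"
    if k: "k \<le> 1" and l: "length vs = 3 + k" for k vs
  proof (rule length_3_plusE[OF l])
    fix u v w assume "k = 0" "vs = [u, v, w]"
    then show ?thesis using \<alpha>(1)
      by (simp add: nabla_curv_op_0 H_def area_form_boost area_form_scaleR null_rotation_scaleR null_rotation_boost h2 linear_cmul[OF linear_boost] power2_eq_square mult_ac)
  next
    fix u v w a assume "k = 1" "vs = [u, v, w, a]"
    then show ?thesis using \<alpha>(1)
      by (simp add: nabla_curv_op_1[OF h] H_def area_form_boost area_form_scaleR null_rotation_scaleR null_rotation_boost h3 linear_cmul[OF linear_boost]
          power2_eq_square power3_eq_cube mult_ac del: One_nat_def)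
  qed (use k in auto)
  ultimately show "\<exists>H. homothety (metric_h h P) (metric_h h Q) H \<and>
       (\<forall>k\<le>1. \<forall>vs. length vs = 3 + k \<longrightarrow>
          inv H (nabla_curv_op k (metric_h h) Q (map H vs)) = nabla_curv_op k (metric_h h) P vs)"
    using hom by blast
qed

section \<open>Scalar identities forced by CH_1 and SCH_2(1,3)\<close>

lemma curvature_homogeneous_1_ratio:
  fixes P Q :: "real ^ 3"
  assumes "\<forall>t. (deriv ^^ 2) h t \<noteq> 0" "curvature_homogeneous 1 (metric_h h)"
  shows "((deriv ^^ 3) h (P $ 1) / (deriv ^^ 2) h (P $ 1))\<^sup>2 = ((deriv ^^ 3) h (Q $ 1) / (deriv ^^ 2) h (Q $ 1))\<^sup>2"
proof -
  obtain F where F: "linear_isometry (metric_h h P) (metric_h h Q) F"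
    and T: "\<And>k vs. k \<le> 1 \<Longrightarrow> length vs = 4 + k \<Longrightarrow>
      nabla_curv_tensor k (metric_h h) Q (map F vs) = nabla_curv_tensor k (metric_h h) P vs"
    using assms(2) unfolding curvature_homogeneous_def by blast
  let ?e1 = "axis 1 1 :: real ^ 3" and ?e2 = "axis 2 1 :: real ^ 3"
  define K where "K = area_form (F ?e1) (F ?e2) * area_form (F ?e1) (F ?e2)"
  have h2: "(deriv ^^ 2) h (Q $ 1) * K = (deriv ^^ 2) h (P $ 1)"
    using T[of 0 "[?e1, ?e2, ?e2, ?e1]"]
    by (simp add: nabla_curv_tensor_0 K_def area_form_def axis_def)
  have h3: "(deriv ^^ 3) h (Q $ 1) * K * F a $ 1 = (deriv ^^ 3) h (P $ 1) * a $ 1" for a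
    using T[of 1 "[?e1, ?e2, ?e2, ?e1, a]"]
    by (simp add: nabla_curv_tensor_1[OF h] K_def area_form_def axis_def del: One_nat_def)
  have K: "K \<noteq> 0" using h2 assms(1) by (metis mult_zero_right)
  obtain b where b: "F b = ?e1" using F unfolding linear_isometry_def by (metis bij_pointE)
  \<comment> \<open>dt is pairing with \<partial>t = \<open>F b\<close>, so the isometry property
    turns dt(F a) into pairing with \<open>b\<close>.\<close>
  have i: "F a $ 1 = form (metric_h h P) a b" for a
  proof -
    have "form (metric_h h Q) (F a) ?e1 = form (metric_h h P) a b"
      using F b unfolding linear_isometry_def by metis
    then show ?thesis by (simp add: form_metric_h[of h Q] axis_def)
  qed
  have r: "(deriv ^^ 3) h (Q $ 1) * K = (deriv ^^ 3) h (P $ 1) * b $ 1"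
    using h3[of b] b by (simp add: axis_def)
  have r': "(deriv ^^ 3) h (Q $ 1) * K * b $ 1 = (deriv ^^ 3) h (P $ 1)"
    using h3[of ?e1] i[of ?e1] by (simp add: form_metric_h axis_def)
  \<comment> \<open>\<open>r\<close> and \<open>r'\<close> are multiplied together rather than
    solved for \<open>b $ 1\<close>, as h''' may vanish.\<close>
  have "((deriv ^^ 3) h (Q $ 1) * K) * ((deriv ^^ 3) h (Q $ 1) * K)
      = (deriv ^^ 3) h (P $ 1) * b $ 1 * ((deriv ^^ 3) h (Q $ 1) * K)"
    by (simp only: r)
  also have "\<dots> = (deriv ^^ 3) h (P $ 1) * ((deriv ^^ 3) h (Q $ 1) * K * b $ 1)"
    by (simp only: mult_ac)
  also have "\<dots> = (deriv ^^ 3) h (P $ 1) * (deriv ^^ 3) h (P $ 1)"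
    by (simp only: r')
  finally have "((deriv ^^ 3) h (P $ 1))\<^sup>2 = ((deriv ^^ 3) h (Q $ 1))\<^sup>2 * K\<^sup>2"
    by (simp add: power2_eq_square mult_ac)
  then show ?thesis
    using K by (simp add: h2[symmetric] power_divide power_mult_distrib)
qed

text \<open>The first covariant derivative forces dt(H \<partial>x) = 0 because h''' is nonzero.
  Then R gives h''(Q) m = h''(P) with m the square of dx(H \<partial>x), and the second covariant
  derivative on \<partial>x, \<partial>x compares h' h''' at P and Q through m. Eliminating m leaves
  the ratio.\<close>

lemma strongly_curvature_homogeneous_2_ratio:
  fixes P Q :: "real ^ 3"
  assumes h2: "\<forall>t. (deriv ^^ 2) h t \<noteq> 0" and h3: "\<forall>t. (deriv ^^ 3) h t \<noteq> 0"
    and "strongly_curvature_homogeneous_13 2 (metric_h h)"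
  shows "deriv h (P $ 1) * (deriv ^^ 3) h (P $ 1) / ((deriv ^^ 2) h (P $ 1))\<^sup>2
    = deriv h (Q $ 1) * (deriv ^^ 3) h (Q $ 1) / ((deriv ^^ 2) h (Q $ 1))\<^sup>2"
proof -
  obtain H where H: "homothety (metric_h h P) (metric_h h Q) H"
    and T': "\<And>k vs. k \<le> 2 \<Longrightarrow> length vs = 3 + k \<Longrightarrow>
      inv H (nabla_curv_op k (metric_h h) Q (map H vs)) = nabla_curv_op k (metric_h h) P vs"
    using assms(3) unfolding strongly_curvature_homogeneous_13_def by blast
  obtain c F where cF: "c > 0" "linear F" "bij F" "H = (\<lambda>u. c *\<^sub>R F u)"
    using H unfolding homothety_def linear_isometry_def by blast
  have lin: "linear H" using cF by (simp add: linear_compose_scale_right)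
  have sur: "surj H"
  proof (rule surjI)
    show "H (inv F (y /\<^sub>R c)) = y" for y
      using cF by (simp add: surj_f_inv_f bij_is_surj)
  qed
  have T: "nabla_curv_op k (metric_h h) Q (map H vs) = H (nabla_curv_op k (metric_h h) P vs)"
    if "k \<le> 2" "length vs = 3 + k" for k vs
    using T'[OF that] surj_f_inv_f[OF sur] by metis
  let ?e1 = "axis 1 1 :: real ^ 3" and ?e2 = "axis 2 1 :: real ^ 3"
  define K where "K = area_form (H ?e1) (H ?e2)"
  have E: "null_rotation ?e2 = ?e1" by (simp add: null_rotation_def vec_eq_iff forall_3 axis_def)
  have He1: "H ?e1 \<noteq> 0"
  proof
    assume "H ?e1 = 0"
    then have "F ?e1 = F 0" using cF by (simp add: linear_0)
    then have "?e1 = (0 :: real ^ 3)" using cF(3) by (metis bij_pointE)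
    then show False by simp
  qed
  define g2 where "g2 P = (deriv ^^ 2) h (P $ 1)" for P :: "real ^ 3"
  define g3 where "g3 P = (deriv ^^ 3) h (P $ 1)" for P :: "real ^ 3"
  define g4 where "g4 P = (deriv ^^ 4) h (P $ 1)" for P :: "real ^ 3"
  define g1 where "g1 P = deriv h (P $ 1)" for P :: "real ^ 3"
  note g = g1_def[symmetric] g2_def[symmetric] g3_def[symmetric] g4_def[symmetric]
  have n: "g2 P \<noteq> 0" "g2 Q \<noteq> 0" "g3 P \<noteq> 0" "g3 Q \<noteq> 0" using h2 h3 by (simp_all add: g2_def g3_def)
  have om12: "area_form ?e1 ?e2 = 1" by (simp add: area_form_def axis_def)
  have t0: "(g2 Q * K) *\<^sub>R null_rotation (H ?e2) = g2 P *\<^sub>R H ?e1"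
    using T[of 0 "[?e1, ?e2, ?e2]"] unfolding K_def[symmetric]
    by (simp add: nabla_curv_op_0 om12 E g linear_cmul[OF lin] flip: K_def)
  have t1: "(g3 Q * (K * H a $ 1)) *\<^sub>R null_rotation (H ?e2) = (g3 P * a $ 1) *\<^sub>R H ?e1" for a
    using T[of 1 "[?e1, ?e2, ?e2, a]"]
    by (simp add: nabla_curv_op_1[OF h] om12 E g linear_cmul[OF lin] del: One_nat_def flip: K_def)
  have t2: "((g4 Q * H a $ 1 * H b $ 1 - g3 Q * g1 Q * H a $ 2 * H b $ 2) * K) *\<^sub>R null_rotation (H ?e2)
    = (g4 P * a $ 1 * b $ 1 - g3 P * g1 P * a $ 2 * b $ 2) *\<^sub>R H ?e1" for a b
    using T[of 2 "[?e1, ?e2, ?e2, a, b]"]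
    by (simp add: nabla_curv_op_2[OF h] om12 E g linear_cmul[OF lin] flip: K_def)
  have K0: "K \<noteq> 0" using t0 n He1 by auto
  have E0: "null_rotation (H ?e2) \<noteq> 0" using t0 n He1 by auto
  \<comment> \<open>After this substitution both sides of the tensor identities are multiples of the
    one nonzero vector \<open>null_rotation (H ?e2)\<close>, so coefficients can be
    compared.\<close>
  have He: "H ?e1 = (g2 Q * K / g2 P) *\<^sub>R null_rotation (H ?e2)"
  proof -
    have "(g2 Q * K / g2 P) *\<^sub>R null_rotation (H ?e2) = (1 / g2 P) *\<^sub>R (g2 Q * K) *\<^sub>R null_rotation (H ?e2)"
      by simp
    then show ?thesis unfolding t0 using n by simp
  qed
  have "g3 Q * (K * H ?e2 $ 1) = 0"
    using t1[of ?e2] E0 by (simp add: axis_def)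
  then have z: "H ?e2 $ 1 = 0" using n K0 by simp
  have "(- (g3 Q * g1 Q * (H ?e2 $ 2)\<^sup>2 * K)) *\<^sub>R null_rotation (H ?e2) = (- (g3 P * g1 P * (g2 Q * K / g2 P))) *\<^sub>R null_rotation (H ?e2)"
  proof -
    have "?e2 $ 1 = 0" "?e2 $ 2 = 1" by (simp_all add: axis_def)
    then show ?thesis using t2[of ?e2 ?e2] unfolding He by (simp add: z power2_eq_square mult.assoc)
  qed
  then have "- (g3 Q * g1 Q * (H ?e2 $ 2)\<^sup>2 * K) = - (g3 P * g1 P * (g2 Q * K / g2 P))"
    using E0 by (simp only: scaleR_cancel_right) simp
  then have "(g3 Q * g1 Q * (H ?e2 $ 2)\<^sup>2) * K = (g3 P * g1 P * (g2 Q / g2 P)) * K" by simp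
  then have s1: "g3 Q * g1 Q * (H ?e2 $ 2)\<^sup>2 = g3 P * g1 P * (g2 Q / g2 P)"
    by (simp only: mult_right_cancel[OF K0])
  \<comment> \<open>The first component of \<open>null_rotation w\<close> is \<open>w $ 2\<close>.
    Together with \<open>b\<close> this eliminates \<open>H ?e1 $ 1\<close> and determines the
    square of \<open>H ?e2 $ 2\<close>.\<close>
  have a: "H ?e1 $ 1 = g2 Q * K / g2 P * H ?e2 $ 2"
    by (subst He) (simp add: null_rotation_def)
  have b: "K = H ?e1 $ 1 * H ?e2 $ 2" by (simp add: K_def area_form_def z)
  have "g2 Q / g2 P * (H ?e2 $ 2)\<^sup>2 * K = 1 * K"
    using b[unfolded a] by (simp add: power2_eq_square mult_ac)
  then have "g2 Q / g2 P * (H ?e2 $ 2)\<^sup>2 = 1" by (simp only: mult_right_cancel[OF K0])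
  then have s2: "(H ?e2 $ 2)\<^sup>2 = g2 P / g2 Q" using n by (simp add: field_simps)
  show ?thesis
    using s1 n unfolding s2 by (simp add: g power2_eq_square field_simps)
qed

end

subsection \<open>Exponential \<open>h\<close>\<close>

lemma affine_has_derivative:
  assumes "linear (L :: 'a::euclidean_space \<Rightarrow> 'b::real_normed_vector)"
  shows "((\<lambda>p. c + L (p - a)) has_derivative L) (at p)"
proof -
  have "((\<lambda>p. p - a) has_derivative (\<lambda>v. v)) (at p)" by (auto intro!: derivative_eq_intros)
  from has_derivative_add[OF has_derivative_const
      bounded_linear.has_derivative[OF linear_conv_bounded_linear[THEN iffD1, OF assms] this], of c]
  show ?thesis by simp
qed

lemma smooth_on_affine:
  assumes "linear (L :: 'a::euclidean_space \<Rightarrow> 'b::real_normed_vector)"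
  shows "smooth_on S (\<lambda>p. c + L (p - a))"
proof -
  note D = affine_has_derivative[OF assms, of c a]
  have "Ck_on k S (\<lambda>p. c + L (p - a))" for k
  proof (cases k)
    case 0
    then show ?thesis
      using has_derivative_continuous[OF D] by (simp add: continuous_at_imp_continuous_on)
  next
    case (Suc m)
    then show ?thesis
      unfolding Suc Ck_on.simps frechet_derivative_at[OF D, symmetric]
      using D by (auto simp: differentiable_def Ck_on_const)
  qed
  then show ?thesis by (simp add: smooth_on_def)
qed

text \<open>The affine map with linear part a boost taking P to Q translates t by
  \<open>Q $ 1 - P $ 1\<close>. The second assumption is the isometry condition at every point p, so
  this map is an isometry of the whole space.\<close>

lemma locally_isometric_boost:
  assumes "\<alpha> \<noteq> 0" "\<And>p :: real ^ 3. \<alpha> * \<beta> = k (p $ 1 + Q $ 1 - P $ 1) * \<alpha>\<^sup>2 - h (p $ 1)"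
  shows "locally_isometric_at (metric_h h) P (metric_h k) Q"
proof -
  define \<phi> where "\<phi> p = Q + boost \<alpha> \<beta> (p - P)" for p
  define \<psi> where "\<psi> q = P + boost (1 / \<alpha>) (- \<beta>) (q - Q)" for q
  have i: "\<psi> (\<phi> p) = p" "\<phi> (\<psi> p) = p" for p
    using assms(1) by (simp_all add: \<phi>_def \<psi>_def boost_inverse boost_inverse')
  have s: "\<phi> ` UNIV = UNIV" by (rule surjI[where f = \<psi>]) (rule i(2))
  have D: "frechet_derivative \<phi> (at p) = boost \<alpha> \<beta>" for p
    using frechet_derivative_at[OF affine_has_derivative[OF linear_boost, of Q _ _ P p]]
    unfolding \<phi>_def by simp
  have sm: "smooth_on UNIV \<phi>" "smooth_on UNIV \<psi>"
    unfolding \<phi>_def \<psi>_def by (intro smooth_on_affine linear_boost)+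
  have iso: "linear_isometry (metric_h h p) (metric_h k (\<phi> p)) (frechet_derivative \<phi> (at p))" for p
    unfolding D by (rule linear_isometry_boost[OF assms(1)])
      (use assms(2)[of p] in \<open>simp add: \<phi>_def algebra_simps\<close>)
  show ?thesis
    unfolding locally_isometric_at_def
    by (rule exI[of _ UNIV], rule exI[of _ UNIV], rule exI[of _ \<phi>], rule exI[of _ \<psi>])
      (use i s sm iso in \<open>auto simp: \<phi>_def linear_0[OF linear_boost]\<close>)
qed

text \<open>A translation of t multiplies the exponential term by a constant, which the square of
  \<alpha> undoes; the shear absorbs the resulting change in C.\<close>

lemma locally_homogeneous_exponential:
  fixes A \<kappa> C :: real
  assumes "\<And>t. h t = A * exp (\<kappa> * t) + C"
  shows "locally_homogeneous (metric_h h)"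
  unfolding locally_homogeneous_def
proof (intro allI)
  fix P Q :: "real ^ 3"
  define \<alpha> where "\<alpha> = exp (- (\<kappa> * (Q $ 1 - P $ 1) / 2))"
  have \<alpha>: "\<alpha> \<noteq> 0" by (simp add: \<alpha>_def)
  have sq: "\<alpha>\<^sup>2 = exp (- (\<kappa> * (Q $ 1 - P $ 1)))" by (simp add: \<alpha>_def flip: exp_double)
  show "locally_isometric_at (metric_h h) P (metric_h h) Q"
  proof (rule locally_isometric_boost[OF \<alpha>, of "C * (\<alpha>\<^sup>2 - 1) / \<alpha>"])
    fix p :: "real ^ 3"
    have "exp (\<kappa> * (p $ 1 + Q $ 1 - P $ 1)) * \<alpha>\<^sup>2 = exp (\<kappa> * p $ 1)"
      unfolding sq exp_add[symmetric] by (simp add: algebra_simps)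
    then have "A * (exp (\<kappa> * (p $ 1 + Q $ 1 - P $ 1)) * \<alpha>\<^sup>2) = A * exp (\<kappa> * p $ 1)" by simp
    then have "h (p $ 1 + Q $ 1 - P $ 1) * \<alpha>\<^sup>2 - h (p $ 1) = C * (\<alpha>\<^sup>2 - 1)"
      unfolding assms by argo
    then show "\<alpha> * (C * (\<alpha>\<^sup>2 - 1) / \<alpha>) = h (p $ 1 + Q $ 1 - P $ 1) * \<alpha>\<^sup>2 - h (p $ 1)"
      using \<alpha> by simp
  qed
qed

section \<open>Recovering exponential h from the constant ratio\<close>

lemma deriv2_proportional:
  fixes h :: "real \<Rightarrow> real"
  assumes h: "smooth_on UNIV h" and h1: "\<forall>t. deriv h t \<noteq> 0" and h2: "\<forall>t. (deriv ^^ 2) h t \<noteq> 0"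
    and const: "\<And>s t. deriv h s * (deriv ^^ 3) h s / ((deriv ^^ 2) h s)\<^sup>2 = deriv h t * (deriv ^^ 3) h t / ((deriv ^^ 2) h t)\<^sup>2"
  obtains \<kappa> where "\<kappa> \<noteq> 0" "(deriv ^^ 2) h = (\<lambda>t. \<kappa> * deriv h t)"
proof -
  note D1 = second_deriv_has_real_derivative(1)[OF h] and D2 = second_deriv_has_real_derivative(2)[OF h]
  \<comment> \<open>The derivative of h'/h'' is 1 - h' h'''/(h'')^2, which is constant by
    \<open>const\<close>; \<open>q\<close> is its value and \<open>f\<close> is h'/h'' without its
    linear part.\<close>
  define q where "q = 1 - deriv h 0 * (deriv ^^ 3) h 0 / ((deriv ^^ 2) h 0)\<^sup>2"
  define f where "f t = deriv h t / (deriv ^^ 2) h t - q * t" for t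
  have "(f has_real_derivative 0) (at t)" for t
  proof -
    have e: "deriv h t * (deriv ^^ 3) h t / ((deriv ^^ 2) h t)\<^sup>2 = 1 - q"
      using const[of t 0] by (simp add: q_def)
    have "(f has_real_derivative
        ((deriv ^^ 2) h t * (deriv ^^ 2) h t - deriv h t * (deriv ^^ 3) h t) / ((deriv ^^ 2) h t * (deriv ^^ 2) h t) - q) (at t)"
      unfolding f_def using h2 by (intro DERIV_diff DERIV_divide D1 D2 DERIV_cmult_Id) auto
    moreover have "((deriv ^^ 2) h t * (deriv ^^ 2) h t - deriv h t * (deriv ^^ 3) h t) / ((deriv ^^ 2) h t * (deriv ^^ 2) h t)
       = 1 - deriv h t * (deriv ^^ 3) h t / ((deriv ^^ 2) h t)\<^sup>2"
      using h2 by (simp add: diff_divide_distrib power2_eq_square)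
    ultimately show ?thesis unfolding e by simp
  qed
  then have "f t = f 0" for t by (intro DERIV_isconst_all) blast
  then have lin: "deriv h t / (deriv ^^ 2) h t = q * t + f 0" for t
    unfolding f_def by (metis add.commute diff_add_cancel)
  have "q = 0"
  proof (rule ccontr)
    assume "q \<noteq> 0"
    \<comment> \<open>A nonconstant affine function has a zero, here at \<open>- f 0 / q\<close>,
      whereas h' has none.\<close>
    then have "deriv h (- f 0 / q) / (deriv ^^ 2) h (- f 0 / q) = 0" by (simp add: lin)
    then show False using h1 h2 by simp
  qed
  then have e: "deriv h t = f 0 * (deriv ^^ 2) h t" for t
    using lin[of t] h2 by (simp add: field_simps)
  have n: "f 0 \<noteq> 0" using e[of 0] h1 by (metis mult_zero_left)
  show thesis
    by (rule that[of "1 / f 0"]) (use n in \<open>simp_all add: fun_eq_iff e\<close>)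
qed

lemma exponential_of_deriv2:
  fixes h :: "real \<Rightarrow> real"
  assumes h: "smooth_on UNIV h" and "\<kappa> \<noteq> 0" and e: "(deriv ^^ 2) h = (\<lambda>t. \<kappa> * deriv h t)"
  obtains A C where "\<And>t. h t = A * exp (\<kappa> * t) + C"
proof -
  have D1: "(deriv h has_real_derivative \<kappa> * deriv h t) (at t)" for t
    using second_deriv_has_real_derivative(1)[OF h, of t] by (simp add: e)
  \<comment> \<open>Integrating factor for the equation h'' = \<kappa> h'.\<close>
  define f where "f t = deriv h t * exp (- (\<kappa> * t))" for t
  have "(f has_real_derivative 0) (at t)" for t
    unfolding f_def by (rule derivative_eq_intros D1 refl)+ simp
  then have "f t = f 0" for t by (intro DERIV_isconst_all) blast
  then have h1: "deriv h t = f 0 * exp (\<kappa> * t)" for t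
    unfolding f_def by (metis exp_minus_inverse mult.assoc mult.commute mult.right_neutral)
  define g where "g t = h t - f 0 / \<kappa> * exp (\<kappa> * t)" for t
  have "(g has_real_derivative 0) (at t)" for t
    unfolding g_def
    by (rule derivative_eq_intros smooth_has_real_derivative[OF h] refl)+ (use assms(2) in \<open>simp add: h1\<close>)
  then have "g t = g 0" for t by (intro DERIV_isconst_all) blast
  then show thesis
    by (intro that[of "f 0 / \<kappa>" "g 0"]) (metis add.commute diff_add_cancel g_def)
qed

text \<open>All derivatives of h are multiples of the same exponential, so one \<alpha> matches h'',
  h''' and h'''' at the two points; the product h''' h' picks up the exponential ratio twice, hence
  the fourth power of \<alpha>.\<close>

lemma curvature_homogeneous_exponential:
  fixes A \<kappa> C :: real
  assumes h: "smooth_on UNIV h" and h2: "\<forall>t. (deriv ^^ 2) h t \<noteq> 0"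
    and e: "\<And>t. h t = A * exp (\<kappa> * t) + C"
  shows "curvature_homogeneous 2 (metric_h h)"
proof (rule curvature_homogeneousI[OF h])
  fix P Q :: "real ^ 3"
  have D: "deriv (\<lambda>t. B * exp (\<kappa> * t) + E) = (\<lambda>t. B * \<kappa> * exp (\<kappa> * t))" for B E
    by (intro ext DERIV_imp_deriv) (auto intro!: derivative_eq_intros)
  \<comment> \<open>Indexed from order 1, since the constant C disappears with the first
    derivative.\<close>
  have n: "(deriv ^^ Suc n) h = (\<lambda>t. A * \<kappa> ^ Suc n * exp (\<kappa> * t))" for n
  proof (induction n)
    case 0
    have "h = (\<lambda>t. A * exp (\<kappa> * t) + C)" using e by blast
    then show ?case using D[of A C] by simp
  next
    case (Suc n)
    then show ?case using D[of "A * \<kappa> ^ Suc n" 0] by (simp add: mult_ac)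
  qed
  have d: "deriv h = (\<lambda>t. A * \<kappa> * exp (\<kappa> * t))"
    "(deriv ^^ 2) h = (\<lambda>t. A * \<kappa> ^ 2 * exp (\<kappa> * t))"
    "(deriv ^^ 3) h = (\<lambda>t. A * \<kappa> ^ 3 * exp (\<kappa> * t))"
    "(deriv ^^ 4) h = (\<lambda>t. A * \<kappa> ^ 4 * exp (\<kappa> * t))"
    using n[of 0] n[of 1] n[of 2] n[of 3] by (simp_all add: eval_nat_numeral)
  define \<alpha> where "\<alpha> = exp (\<kappa> * (P $ 1 - Q $ 1) / 2)"
  have s: "\<alpha>\<^sup>2 = exp (\<kappa> * (P $ 1 - Q $ 1))" by (simp add: \<alpha>_def flip: exp_double)
  have m: "exp (\<kappa> * Q $ 1) * \<alpha>\<^sup>2 = exp (\<kappa> * P $ 1)"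
    unfolding s exp_add[symmetric] by (simp add: algebra_simps)
  have "c * exp (\<kappa> * Q $ 1) * \<alpha>\<^sup>2 = c * exp (\<kappa> * P $ 1)" for c
    by (simp only: mult.assoc m)
  moreover have "c * exp (\<kappa> * Q $ 1) * (c' * exp (\<kappa> * Q $ 1)) * \<alpha> ^ 4 = c * exp (\<kappa> * P $ 1) * (c' * exp (\<kappa> * P $ 1))" for c c'
    unfolding m[symmetric] by (simp add: power4_eq_xxxx power2_eq_square mult_ac)
  moreover have "\<alpha> \<noteq> 0" by (simp add: \<alpha>_def)
  ultimately show "\<exists>\<alpha>. \<alpha> \<noteq> 0 \<and> (deriv ^^ 2) h (Q $ 1) * \<alpha>\<^sup>2 = (deriv ^^ 2) h (P $ 1)
      \<and> ((2 :: nat) \<ge> 1 \<longrightarrow> (deriv ^^ 3) h (Q $ 1) * \<alpha>\<^sup>2 = (deriv ^^ 3) h (P $ 1))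
      \<and> ((2 :: nat) \<ge> 2 \<longrightarrow> (deriv ^^ 4) h (Q $ 1) * \<alpha>\<^sup>2 = (deriv ^^ 4) h (P $ 1)
           \<and> (deriv ^^ 3) h (Q $ 1) * deriv h (Q $ 1) * \<alpha> ^ 4 = (deriv ^^ 3) h (P $ 1) * deriv h (P $ 1))"
    unfolding d by blast
qed simp

theorem theorem1p7:
  fixes h :: "real \<Rightarrow> real"
  assumes "smooth_on UNIV h"
    and "\<forall>t. (deriv ^^ 2) h t \<noteq> 0"
  shows "curvature_homogeneous 0 (metric_h h)
    \<and> ((\<forall>t. (deriv ^^ 3) h t \<noteq> 0) \<longrightarrow> strongly_curvature_homogeneous_13 1 (metric_h h))
    \<and> isometry_invariant (\<lambda>h. smooth_on UNIV h \<and> (\<forall>t. (deriv ^^ 2) h t \<noteq> 0))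
        (\<lambda>h P. ((deriv ^^ 3) h (P $ 1) / (deriv ^^ 2) h (P $ 1))\<^sup>2)
    \<and> (\<not> (\<lambda>P :: real ^ 3. ((deriv ^^ 3) h (P $ 1) / (deriv ^^ 2) h (P $ 1))\<^sup>2) constant_on UNIV
        \<longrightarrow> \<not> curvature_homogeneous 1 (metric_h h) \<and> \<not> locally_homogeneous (metric_h h))
    \<and> ((\<forall>t. deriv h t \<noteq> 0) \<and> (\<forall>t. (deriv ^^ 3) h t \<noteq> 0) \<longrightarrow>
        (strongly_curvature_homogeneous_13 2 (metric_h h) \<longrightarrow> curvature_homogeneous 2 (metric_h h))
        \<and> (real_analytic h \<and> strongly_curvature_homogeneous_13 2 (metric_h h)
             \<longrightarrow> locally_homogeneous (metric_h h)))"
proof (intro conjI impI)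
  note h = assms(1) and h2 = assms(2)
  let ?I = "\<lambda>P :: real ^ 3. ((deriv ^^ 3) h (P $ 1) / (deriv ^^ 2) h (P $ 1))\<^sup>2"
  show "curvature_homogeneous 0 (metric_h h)"
    by (rule curvature_homogeneous_0[OF h h2])
  show "strongly_curvature_homogeneous_13 1 (metric_h h)" if "\<forall>t. (deriv ^^ 3) h t \<noteq> 0"
    by (rule strongly_curvature_homogeneous_1[OF h h2 that])
  show "isometry_invariant (\<lambda>h. smooth_on UNIV h \<and> (\<forall>t. (deriv ^^ 2) h t \<noteq> 0))
        (\<lambda>h P. ((deriv ^^ 3) h (P $ 1) / (deriv ^^ 2) h (P $ 1))\<^sup>2)"
    by (rule isometry_invariant_ratio)
  {
    assume "\<not> ?I constant_on UNIV"
    then obtain P Q where ne: "?I P \<noteq> ?I Q"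
      unfolding constant_on_def by blast
    show "\<not> curvature_homogeneous 1 (metric_h h)"
      using curvature_homogeneous_1_ratio[OF h h2, of P Q] ne by blast
    \<comment> \<open>The invariant is applied with the same function h on both sides: a local
      isometry from P to Q would equate its values there.\<close>
    show "\<not> locally_homogeneous (metric_h h)"
      using isometry_invariant_ratio h h2 ne unfolding isometry_invariant_def locally_homogeneous_def by blast
  }
  {
    assume n: "(\<forall>t. deriv h t \<noteq> 0) \<and> (\<forall>t. (deriv ^^ 3) h t \<noteq> 0)"
      and S: "strongly_curvature_homogeneous_13 2 (metric_h h)"
    have "deriv h s * (deriv ^^ 3) h s / ((deriv ^^ 2) h s)\<^sup>2 = deriv h t * (deriv ^^ 3) h t / ((deriv ^^ 2) h t)\<^sup>2" for s t
      \<comment> \<open>Points with all coordinates equal to s and to t turn the identity between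
        points into one between arbitrary parameters.\<close>
      using strongly_curvature_homogeneous_2_ratio[OF h h2 conjunct2[OF n] S, of "\<chi> i. s" "\<chi> i. t"] by simp
    then obtain \<kappa> where "\<kappa> \<noteq> 0" "(deriv ^^ 2) h = (\<lambda>t. \<kappa> * deriv h t)"
      using deriv2_proportional[OF h conjunct1[OF n] h2] by blast
    then obtain A C where "h t = A * exp (\<kappa> * t) + C" for t
      using exponential_of_deriv2[OF h] by blast
    then have "\<exists>A \<kappa> C. \<forall>t. h t = A * exp (\<kappa> * t) + C" by blast
  } note exponential = this
  show "curvature_homogeneous 2 (metric_h h)"
    if n: "(\<forall>t. deriv h t \<noteq> 0) \<and> (\<forall>t. (deriv ^^ 3) h t \<noteq> 0)"
      and S: "strongly_curvature_homogeneous_13 2 (metric_h h)"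
  proof -
    obtain A \<kappa> C where "\<And>t. h t = A * exp (\<kappa> * t) + C" using exponential[OF n S] by blast
    then show ?thesis by (rule curvature_homogeneous_exponential[OF h h2])
  qed
  show "locally_homogeneous (metric_h h)"
    if n: "(\<forall>t. deriv h t \<noteq> 0) \<and> (\<forall>t. (deriv ^^ 3) h t \<noteq> 0)"
      and S: "real_analytic h \<and> strongly_curvature_homogeneous_13 2 (metric_h h)"
  proof -
    obtain A \<kappa> C where "\<And>t. h t = A * exp (\<kappa> * t) + C" using exponential[OF n conjunct2[OF S]] by blast
    then show ?thesis by (rule locally_homogeneous_exponential)
  qed
qed

end
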